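(* Let $\mathcal H$ be a separable infinite-dimensional complex Hilbert space. (1) Every compact operator $T$ on $\mathcal H$ is unitarily equivalent to the sum of an upper triangularizable compact operator and a compact quasinilpotent operator. Moreover, with the unitary $U_0$, the operators $K=W^*TW$ and $\Delta$, and the blocks $B_n$ associated with $T$ as described in the context, one has $\sigma(U_0^*TU_0-\Delta)=\{0\}$. In particular, if $B_n=0$ for all $n\ge 1$, then $K=W^*TW$ is (upper) triangularizable. (2) Alternatively: every compact operator on $\mathcal H$ is unitarily equivalent to a compact operator $K'$ which has a normal part $N$ (the diagonal part of the upper triangular matrix $\Delta$ described in the context, where $K'=U_0^*TU_0$) such that $K'-N$ is a sum of two compact quasinilpotent operators.
   Context: Conventions: $\sigma(\cdot)$ denotes the spectrum; a bounded operator is quasinilpotent if its spectrum is $\{0\}$. An operator $R$ on $\mathcal H$ is upper triangularizable if there is a unitary operator $V$ such that the matrix of $V^*RV$ with respect to the orthonormal basis $\{f_m\}_{m\ge1}$ under consideration is upper triangular. Operators are identified with their matrices with respect to $\{f_m\}$. Notation: Let $T$ be a compact operator on $\mathcal H$, and let $k_1=1$, $k_n=2\cdot 3^{\,n-2}$ for $n\ge 2$. It is a known fact that there are an orthonormal basis $\{f_m\}_{m\ge 1}$ of $\mathcal H$ and a unitary operator $W$ such that the matrix of $K:=W^*TW$ with respect to $\{f_m\}$ has the block-tridiagonal form $$ K=\begin{pmatrix} C_1 & A_1 & 0 & \cdots \\ B_1 & C_2 & A_2 & \ddots\\ 0 & B_2 & C_3 & \ddots\\ \vdots & \ddots & \ddots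 &\ddots\end{pmatrix}, $$ with $C_n$ of size $k_n\times k_n$, $A_n$ of size $k_n\times k_{n+1}$ and $B_n$ of size $k_{n+1}\times k_n$. Write $K=S+Q$, where $$ S=\begin{pmatrix} C_1 & A_1 & 0 & \cdots \\ 0 & C_2 & A_2 & \ddots\\ 0 & 0 & C_3 & \ddots\\ \vdots & \ddots & \ddots &\ddots\end{pmatrix},\qquad Q=\begin{pmatrix} 0 & 0 & 0 & \cdots \\ B_1 & 0 & 0 & \ddots\\ 0 & B_2 & 0 & \ddots\\ \vdots & \ddots & \ddots &\ddots\end{pmatrix}. $$ For each $n\ge1$ choose a unitary matrix $U_n\in M_{k_n}(\mathbb C)$ such that $\Delta_n:=U_n^*C_nU_n$ is upper triangular. Put $U:=\bigoplus_{n\ge 1}U_n$ (a unitary operator on $\mathcal H$), $\Delta:=U^*SU$ and $U_0:=WU$. Thus $\Delta$ has an upper triangular matrix with respect to $\{f_m\}$, and $U_0^*TU_0=U^*KU=\Delta+U^*QU$. *)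

theory Defs
  imports "HOL-Analysis.Analysis" "Jordan_Normal_Form.Schur_Decomposition"
begin

section \<open>Complex Hilbert spaces\<close>

text \<open>The inner product is linear in the first argument.\<close>

class complex_hilbert = banach +
  fixes scaleC :: "complex \<Rightarrow> 'a \<Rightarrow> 'a" (infixr "*\<^sub>C" 75)
    and cinner :: "'a \<Rightarrow> 'a \<Rightarrow> complex"
  assumes scaleC_add_right: "a *\<^sub>C (x + y) = a *\<^sub>C x + a *\<^sub>C y"
    and scaleC_add_left: "(a + b) *\<^sub>C x = a *\<^sub>C x + b *\<^sub>C x"
    and scaleC_scaleC: "a *\<^sub>C b *\<^sub>C x = (a * b) *\<^sub>C x"
    and scaleC_one: "1 *\<^sub>C x = x"
    and scaleR_scaleC: "scaleR r x = complex_of_real r *\<^sub>C x"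
    and cinner_commute: "cinner x y = cnj (cinner y x)"
    and cinner_add_left: "cinner (x + y) z = cinner x z + cinner y z"
    and cinner_scaleC_left: "cinner (a *\<^sub>C x) y = a * cinner x y"
    and cinner_ge_zero: "0 \<le> Re (cinner x x)"
    and norm_eq_sqrt_cinner: "norm x = sqrt (Re (cinner x x))"

global_interpretation complex_vector: vector_space "scaleC :: complex \<Rightarrow> 'a \<Rightarrow> 'a::complex_hilbert"
  defines cspan = complex_vector.span
  by unfold_locales (simp_all add: scaleC_add_right scaleC_add_left scaleC_scaleC scaleC_one)

definition infinite_dimensional :: "'a::complex_hilbert itself \<Rightarrow> bool" where
  "infinite_dimensional _ \<longleftrightarrow> \<not> (\<exists>B::'a set. finite B \<and> cspan B = UNIV)"

definition orthonormal_basis :: "(nat \<Rightarrow> 'a::complex_hilbert) \<Rightarrow> bool" where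
  "orthonormal_basis f \<longleftrightarrow>
     (\<forall>i j. cinner (f i) (f j) = (if i = j then 1 else 0)) \<and> closure (cspan (range f)) = UNIV"

section \<open>Bounded operators\<close>

definition bounded_clinear :: "('a::complex_hilbert \<Rightarrow> 'a) \<Rightarrow> bool" where
  "bounded_clinear A \<longleftrightarrow> bounded_linear A \<and> (\<forall>c x. A (c *\<^sub>C x) = c *\<^sub>C A x)"

definition cadjoint :: "('a::complex_hilbert \<Rightarrow> 'a) \<Rightarrow> 'a \<Rightarrow> 'a" where
  "cadjoint A = (SOME B. \<forall>x y. cinner (A x) y = cinner x (B y))"

definition compact_op :: "('a::complex_hilbert \<Rightarrow> 'a) \<Rightarrow> bool" where
  "compact_op A \<longleftrightarrow> bounded_clinear A \<and> compact (closure (A ` cball 0 1))"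

definition unitary_op :: "('a::complex_hilbert \<Rightarrow> 'a) \<Rightarrow> bool" where
  "unitary_op V \<longleftrightarrow> bounded_clinear V \<and> cadjoint V \<circ> V = id \<and> V \<circ> cadjoint V = id"

definition normal_op :: "('a::complex_hilbert \<Rightarrow> 'a) \<Rightarrow> bool" where
  "normal_op A \<longleftrightarrow> bounded_clinear A \<and> cadjoint A \<circ> A = A \<circ> cadjoint A"

definition op_spectrum :: "('a::complex_hilbert \<Rightarrow> 'a) \<Rightarrow> complex set" where
  "op_spectrum A = {l. \<not> (\<exists>B. bounded_clinear B \<and>
     B \<circ> (\<lambda>x. A x - l *\<^sub>C x) = id \<and> (\<lambda>x. A x - l *\<^sub>C x) \<circ> B = id)}"

definition quasinilpotent :: "('a::complex_hilbert \<Rightarrow> 'a) \<Rightarrow> bool" where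
  "quasinilpotent A \<longleftrightarrow> bounded_clinear A \<and> op_spectrum A = {0}"

definition conj_op :: "('a::complex_hilbert \<Rightarrow> 'a) \<Rightarrow> ('a \<Rightarrow> 'a) \<Rightarrow> 'a \<Rightarrow> 'a" where
  "conj_op V A = cadjoint V \<circ> A \<circ> V"

definition unitarily_equivalent :: "('a::complex_hilbert \<Rightarrow> 'a) \<Rightarrow> ('a \<Rightarrow> 'a) \<Rightarrow> bool" where
  "unitarily_equivalent A B \<longleftrightarrow> (\<exists>V. unitary_op V \<and> B = conj_op V A)"

section \<open>Matrices with respect to an orthonormal basis\<close>

definition entry :: "(nat \<Rightarrow> 'a::complex_hilbert) \<Rightarrow> ('a \<Rightarrow> 'a) \<Rightarrow> nat \<Rightarrow> nat \<Rightarrow> complex" where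
  "entry f A i j = cinner (A (f j)) (f i)"

text \<open>If some bounded operator has the matrix \<open>M\<close> with respect to the orthonormal basis \<open>f\<close>,
  then both series below converge and \<open>op_of_matrix f M\<close> is that operator.\<close>

definition op_of_matrix ::
    "(nat \<Rightarrow> 'a::complex_hilbert) \<Rightarrow> (nat \<Rightarrow> nat \<Rightarrow> complex) \<Rightarrow> 'a \<Rightarrow> 'a" where
  "op_of_matrix f M x = (\<Sum>i. (\<Sum>j. M i j * cinner x (f j)) *\<^sub>C f i)"

definition upper_triangular_op :: "(nat \<Rightarrow> 'a::complex_hilbert) \<Rightarrow> ('a \<Rightarrow> 'a) \<Rightarrow> bool" where
  "upper_triangular_op f A \<longleftrightarrow> (\<forall>i j. j < i \<longrightarrow> entry f A i j = 0)"

definition upper_triangularizable :: "(nat \<Rightarrow> 'a::complex_hilbert) \<Rightarrow> ('a \<Rightarrow> 'a) \<Rightarrow> bool" where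
  "upper_triangularizable f R \<longleftrightarrow> (\<exists>V. unitary_op V \<and> upper_triangular_op f (conj_op V R))"

definition diagonal_part :: "(nat \<Rightarrow> 'a::complex_hilbert) \<Rightarrow> ('a \<Rightarrow> 'a) \<Rightarrow> 'a \<Rightarrow> 'a" where
  "diagonal_part f A = op_of_matrix f (\<lambda>i j. if i = j then entry f A i i else 0)"

section \<open>Block matrices\<close>

text \<open>Basis vectors and blocks are numbered from \<open>0\<close>, so block \<open>n\<close> here is block \<open>n + 1\<close> in
  one-based numbering, of size \<open>k\<^sub>n\<^sub>+\<^sub>1\<close> where \<open>k\<^sub>1 = 1\<close> and \<open>k\<^sub>n = 2 \<cdot> 3\<^sup>n\<^sup>-\<^sup>2\<close> for \<open>n \<ge> 2\<close>.\<close>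

definition bsize :: "nat \<Rightarrow> nat" where
  "bsize n = (if n = 0 then 1 else 2 * 3 ^ (n - 1))"

definition bstart :: "nat \<Rightarrow> nat" where
  "bstart n = (\<Sum>p<n. bsize p)"

definition bindex :: "nat \<Rightarrow> nat" where
  "bindex i = (LEAST n. i < bstart (Suc n))"

definition block :: "(nat \<Rightarrow> 'a::complex_hilbert) \<Rightarrow> ('a \<Rightarrow> 'a) \<Rightarrow> nat \<Rightarrow> nat \<Rightarrow> complex mat" where
  "block f A p q = mat (bsize p) (bsize q) (\<lambda>(i, j). entry f A (bstart p + i) (bstart q + j))"

definition op_of_blocks ::
    "(nat \<Rightarrow> 'a::complex_hilbert) \<Rightarrow> (nat \<Rightarrow> nat \<Rightarrow> complex mat) \<Rightarrow> 'a \<Rightarrow> 'a" where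
  "op_of_blocks f M = op_of_matrix f (\<lambda>i j.
     M (bindex i) (bindex j) $$ (i - bstart (bindex i), j - bstart (bindex j)))"

definition block_tridiagonal :: "(nat \<Rightarrow> 'a::complex_hilbert) \<Rightarrow> ('a \<Rightarrow> 'a) \<Rightarrow> bool" where
  "block_tridiagonal f K \<longleftrightarrow>
     (\<forall>p q. Suc p < q \<or> Suc q < p \<longrightarrow> block f K p q = 0\<^sub>m (bsize p) (bsize q))"

definition C_block :: "(nat \<Rightarrow> 'a::complex_hilbert) \<Rightarrow> ('a \<Rightarrow> 'a) \<Rightarrow> nat \<Rightarrow> complex mat" where
  "C_block f K n = block f K n n"

definition A_block :: "(nat \<Rightarrow> 'a::complex_hilbert) \<Rightarrow> ('a \<Rightarrow> 'a) \<Rightarrow> nat \<Rightarrow> complex mat" where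
  "A_block f K n = block f K n (Suc n)"

definition B_block :: "(nat \<Rightarrow> 'a::complex_hilbert) \<Rightarrow> ('a \<Rightarrow> 'a) \<Rightarrow> nat \<Rightarrow> complex mat" where
  "B_block f K n = block f K (Suc n) n"

definition S_op :: "(nat \<Rightarrow> 'a::complex_hilbert) \<Rightarrow> ('a \<Rightarrow> 'a) \<Rightarrow> 'a \<Rightarrow> 'a" where
  "S_op f K = op_of_blocks f (\<lambda>p q.
     if q = p then C_block f K p else if q = Suc p then A_block f K p
     else 0\<^sub>m (bsize p) (bsize q))"

definition unitary_mat :: "nat \<Rightarrow> complex mat \<Rightarrow> bool" where
  "unitary_mat n X \<longleftrightarrow> X \<in> carrier_mat n n \<and> mat_adjoint X * X = 1\<^sub>m n \<and> X * mat_adjoint X = 1\<^sub>m n"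

definition direct_sum_op :: "(nat \<Rightarrow> 'a::complex_hilbert) \<Rightarrow> (nat \<Rightarrow> complex mat) \<Rightarrow> 'a \<Rightarrow> 'a" where
  "direct_sum_op f Us = op_of_blocks f (\<lambda>p q. if q = p then Us p else 0\<^sub>m (bsize p) (bsize q))"

section \<open>The data attached to a compact operator\<close>

definition tridiagonalization ::
    "('a::complex_hilbert \<Rightarrow> 'a) \<Rightarrow> (nat \<Rightarrow> 'a) \<Rightarrow> ('a \<Rightarrow> 'a) \<Rightarrow> bool" where
  "tridiagonalization T f W \<longleftrightarrow>
     orthonormal_basis f \<and> unitary_op W \<and> block_tridiagonal f (conj_op W T)"

definition triangularizes_blocks ::
    "(nat \<Rightarrow> 'a::complex_hilbert) \<Rightarrow> ('a \<Rightarrow> 'a) \<Rightarrow> (nat \<Rightarrow> complex mat) \<Rightarrow> bool" where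
  "triangularizes_blocks f K Us \<longleftrightarrow>
     (\<forall>n. unitary_mat (bsize n) (Us n) \<and>
          upper_triangular (mat_adjoint (Us n) * C_block f K n * Us n))"

definition Delta_op ::
    "(nat \<Rightarrow> 'a::complex_hilbert) \<Rightarrow> ('a \<Rightarrow> 'a) \<Rightarrow> (nat \<Rightarrow> complex mat) \<Rightarrow> 'a \<Rightarrow> 'a" where
  "Delta_op f K Us = conj_op (direct_sum_op f Us) (S_op f K)"

end

theory Submission
  imports Defs
begin

text \<open>Write \<open>K = W\<^sup>* T W\<close> for the block tridiagonal matrix and \<open>Q\<close> for its part below the block diagonal, so
that \<open>S = K - Q\<close>. Everything rests on two facts about an orthonormal basis \<open>f\<close>.

First, a compact operator whose matrix is strictly triangular, lower or upper, has spectrum \<open>{0}\<close>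
(\<open>strictly_triangular_spectrum\<close>). Let \<open>l \<noteq> 0\<close>. By compactness the rows of \<open>A\<close> from some index \<open>n\<close>
on form an operator of norm less than \<open>\<bar>l\<bar>\<close>, which does not have \<open>l\<close> in its spectrum. The remaining
finitely many rows are put back one at a time. A single row \<open>E\<close> has square zero, and triangularity
makes one of the two products of \<open>E\<close> with the lower rows \<open>R\<close> vanish. If \<open>Y X = 0\<close> then
\<open>(Y - l) (X - l) = - l (X + Y - l)\<close>, so \<open>l\<close> stays outside the spectrum of the sum
(\<open>not_in_spectrum_add\<close>).

Second, keeping only the matrix entries in prescribed finite blocks, at most one in each block row
and each block column, preserves compactness (\<open>ex_compact_masked_operator\<close>): such an operator maps
mutually orthogonal pieces to mutually orthogonal pieces, so its norm is the supremum of the norms of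
the blocks, and the same applies to what remains after the first \<open>n\<close> rows have been removed.
Compactness is used throughout in the form that these remainders tend to \<open>0\<close> in norm. Both \<open>Q\<close> and
the diagonal part of \<open>\<Delta>\<close> are of this kind.

Now \<open>U\<^sup>* K U = \<Delta> + U\<^sup>* Q U\<close>, where \<open>U\<^sup>* Q U\<close> is compact and, like \<open>Q\<close>, maps each block into the next
one, hence is strictly lower triangular with respect to \<open>f\<close>; it is the compact quasinilpotent
summand. If all \<open>B\<^sub>n\<close> vanish, then \<open>Q = 0\<close> and \<open>U\<^sup>* K U = \<Delta>\<close> is upper triangular. Finally, the
diagonal part \<open>N\<close> of \<open>\<Delta>\<close> is compact and normal, and \<open>\<Delta> - N\<close> is compact and strictly upper triangular,
which gives the second quasinilpotent summand.

The data exist because an orthonormal basis can be chosen greedily so that the span of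
\<open>f 0, \<dots>, f (3 k + 2)\<close> contains \<open>T (f k)\<close> and \<open>T\<^sup>* (f k)\<close> (\<open>ex_basis_controlling_images\<close>); as the first \<open>n + 1\<close>
blocks together have \<open>3\<^sup>n\<close> vectors, this makes the matrix block tridiagonal. The matrices \<open>U\<^sub>n\<close>
come from Schur's theorem.\<close>

section \<open>Complex inner products\<close>

lemma norm_sq_eq_cinner: "complex_of_real ((norm x)\<^sup>2) = cinner x (x::'a::complex_hilbert)"
proof -
  have "cnj (cinner x x) = cinner x x" by (metis cinner_commute)
  then have "Im (cinner x x) = 0" by (simp add: complex_eq_iff)
  moreover have "(norm x)\<^sup>2 = Re (cinner x x)"
    by (simp add: norm_eq_sqrt_cinner cinner_ge_zero)
  ultimately show ?thesis by (simp add: complex_eq_iff)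
qed

lemma norm_sq_eq_Re_cinner: "(norm x)\<^sup>2 = Re (cinner x (x::'a::complex_hilbert))"
  by (metis norm_sq_eq_cinner Re_complex_of_real)

lemma cinner_add_right: "cinner z (x + y) = cinner z x + cinner z (y::'a::complex_hilbert)"
  by (metis cinner_commute cinner_add_left complex_cnj_add)

lemma cinner_scaleC_right [simp]: "cinner x (a *\<^sub>C y) = cnj a * cinner x (y::'a::complex_hilbert)"
  by (metis cinner_commute cinner_scaleC_left complex_cnj_mult)

lemma cinner_zero_left [simp]: "cinner 0 (x::'a::complex_hilbert) = 0"
  using cinner_add_left[of 0 0 x] by simp

lemma cinner_zero_right [simp]: "cinner (x::'a::complex_hilbert) 0 = 0"
  using cinner_add_right[of x 0 0] by simp

lemma cinner_diff_left: "cinner (x - y) z = cinner x z - cinner y (z::'a::complex_hilbert)"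
  using cinner_add_left[of "x - y" y z] by simp

lemma cinner_diff_right: "cinner z (x - y) = cinner z x - cinner z (y::'a::complex_hilbert)"
  using cinner_add_right[of z "x - y" y] by simp

lemma cinner_sum_left: "cinner (\<Sum>i\<in>I. g i) z = (\<Sum>i\<in>I. cinner (g i) (z::'a::complex_hilbert))"
  by (induction I rule: infinite_finite_induct) (simp_all add: cinner_add_left)

lemma cinner_sum_right: "cinner z (\<Sum>i\<in>I. g i) = (\<Sum>i\<in>I. cinner z (g i::'a::complex_hilbert))"
  by (induction I rule: infinite_finite_induct) (simp_all add: cinner_add_right)

declare cinner_scaleC_left [simp]

lemma norm_scaleC [simp]: "norm (a *\<^sub>C x) = cmod a * norm (x::'a::complex_hilbert)"
proof -
  have "complex_of_real ((norm (a *\<^sub>C x))\<^sup>2) = (a * cnj a) * cinner x x"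
    by (simp only: norm_sq_eq_cinner) simp
  also have "\<dots> = complex_of_real ((cmod a * norm x)\<^sup>2)"
    by (simp add: norm_sq_eq_cinner[symmetric] complex_norm_square[symmetric] power_mult_distrib)
  finally show ?thesis
    by (simp only: of_real_eq_iff) (simp add: power2_eq_iff_nonneg)
qed

lemma norm_add_sq_of_orthogonal:
  assumes "cinner x y = 0"
  shows "(norm (x + y::'a::complex_hilbert))\<^sup>2 = (norm x)\<^sup>2 + (norm y)\<^sup>2"
proof -
  have "cinner y x = 0" using assms by (metis cinner_commute complex_cnj_zero)
  then show ?thesis
    using assms by (simp add: norm_sq_eq_Re_cinner cinner_add_left cinner_add_right)
qed

lemma norm_cinner_le: "cmod (cinner x y) \<le> norm x * norm (y::'a::complex_hilbert)"
proof (cases "y = 0")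
  case False
  \<comment> \<open>\<open>c y\<close> is the orthogonal projection of \<open>x\<close> onto the line through \<open>y\<close>.\<close>
  define c where "c = cinner x y / cinner y y"
  have yy: "cinner y y \<noteq> 0" using False norm_sq_eq_cinner[of y] by (metis norm_eq_zero of_real_eq_0_iff zero_eq_power2)
  have "cinner (c *\<^sub>C y) (x - c *\<^sub>C y) = c * cnj (cinner x y - c * cinner y y)"
    by (simp add: cinner_diff_right cinner_commute[of y x] cinner_commute[of y y, symmetric] algebra_simps)
  also have "\<dots> = 0" using yy by (simp add: c_def)
  finally have "(norm x)\<^sup>2 = (norm (c *\<^sub>C y))\<^sup>2 + (norm (x - c *\<^sub>C y))\<^sup>2"
    using norm_add_sq_of_orthogonal[of "c *\<^sub>C y" "x - c *\<^sub>C y"] by simp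
  then have "(norm (c *\<^sub>C y))\<^sup>2 \<le> (norm x)\<^sup>2" by simp
  then have "cmod c * norm y \<le> norm x" by (simp add: power2_le_iff_abs_le)
  then have "cmod c * (norm y)\<^sup>2 \<le> norm x * norm y"
    by (simp add: power2_eq_square mult_right_mono mult.assoc[symmetric])
  moreover have "cinner x y = c * complex_of_real ((norm y)\<^sup>2)"
    using yy by (simp add: c_def norm_sq_eq_cinner del: of_real_power)
  ultimately show ?thesis by (simp add: norm_mult norm_power)
qed simp

lemma bounded_linear_cinner_left: "bounded_linear (\<lambda>x. cinner x (y::'a::complex_hilbert))"
  by (rule bounded_linear_intro[where K = "norm y"])
    (simp_all add: cinner_add_left scaleR_scaleC norm_cinner_le scaleR_conv_of_real)

lemma bounded_linear_scaleC_left: "bounded_linear (\<lambda>a. a *\<^sub>C (x::'a::complex_hilbert))"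
  by (rule bounded_linear_intro[where K = "norm x"])
    (simp_all add: scaleC_add_left scaleR_scaleC scaleC_scaleC scaleR_conv_of_real)

section \<open>Bounded complex-linear operators\<close>

lemma bounded_clinearI:
  assumes "\<And>x y. A (x + y) = A x + A y" and "\<And>c x. A (c *\<^sub>C x) = c *\<^sub>C A x"
    and "\<And>x. norm (A x) \<le> K * norm (x::'a::complex_hilbert)"
  shows "bounded_clinear A"
  unfolding bounded_clinear_def
  using assms by (auto intro!: bounded_linear_intro[where K = K] simp: scaleR_scaleC mult.commute)

lemma
  assumes "bounded_clinear A"
  shows bounded_clinear_add: "A (x + y) = A x + A y"
    and bounded_clinear_diff: "A (x - y) = A x - A y"
    and bounded_clinear_scaleC: "A (c *\<^sub>C x) = c *\<^sub>C A x"
    and bounded_clinear_zero: "A 0 = 0"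
    and bounded_clinear_sum: "A (\<Sum>i\<in>I. g i) = (\<Sum>i\<in>I. A (g i))"
  using assms by (auto simp: bounded_clinear_def linear_simps
      dest!: bounded_linear.linear intro: linear_add linear_diff linear_0 linear_sum)

lemma bounded_clinear_bound:
  assumes "bounded_clinear A"
  obtains C where "C \<ge> 0" "\<And>x. norm (A x) \<le> C * norm x"
  using assms bounded_linear.nonneg_bounded[of A] by (metis bounded_clinear_def mult.commute)

lemma bounded_clinear_id: "bounded_clinear id"
  by (rule bounded_clinearI[where K = 1]) auto

lemma bounded_clinear_compose:
  "bounded_clinear A \<Longrightarrow> bounded_clinear B \<Longrightarrow> bounded_clinear (A \<circ> B)"
  by (auto simp: bounded_clinear_def o_def intro: bounded_linear_compose)

lemma bounded_clinear_plus:
  "bounded_clinear A \<Longrightarrow> bounded_clinear B \<Longrightarrow> bounded_clinear (\<lambda>x. A x + B x)"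
  by (auto simp: bounded_clinear_def scaleC_add_right intro: bounded_linear_add)

lemma bounded_clinear_minus:
  "bounded_clinear A \<Longrightarrow> bounded_clinear B \<Longrightarrow> bounded_clinear (\<lambda>x. A x - B x)"
  by (auto simp: bounded_clinear_def complex_vector.scale_right_diff_distrib intro: bounded_linear_sub)

lemma bounded_clinear_scale:
  assumes A: "bounded_clinear A" shows "bounded_clinear (\<lambda>x. a *\<^sub>C A x)"
proof -
  obtain C where "\<And>x. norm (A x) \<le> C * norm x" using bounded_clinear_bound[OF A] by blast
  then have "norm (a *\<^sub>C A x) \<le> (cmod a * C) * norm x" for x
    by (simp add: mult_left_mono mult.assoc)
  then show ?thesis
    using A by (intro bounded_clinearI[where K = "cmod a * C"])
      (auto simp: bounded_clinear_add bounded_clinear_scaleC scaleC_add_right scaleC_scaleC mult.commute[of a])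
qed

section \<open>The spectrum\<close>

lemma not_in_spectrumI:
  assumes "bounded_clinear B" "\<And>x. B (A x - l *\<^sub>C x) = x" "\<And>x. A (B x) - l *\<^sub>C B x = x"
  shows "l \<notin> op_spectrum A"
  using assms unfolding op_spectrum_def by (auto simp: fun_eq_iff)

lemma not_in_spectrumE:
  assumes "l \<notin> op_spectrum A"
  obtains B where "bounded_clinear B" "\<And>x. B (A x - l *\<^sub>C x) = x" "\<And>x. A (B x) - l *\<^sub>C B x = x"
proof -
  obtain B where "bounded_clinear B" "B \<circ> (\<lambda>x. A x - l *\<^sub>C x) = id" "(\<lambda>x. A x - l *\<^sub>C x) \<circ> B = id"
    using assms unfolding op_spectrum_def by blast
  with that[of B] show ?thesis by (auto simp: fun_eq_iff)
qed

text \<open>Because \<open>Y X = 0\<close>, the product \<open>(Y - l) (X - l)\<close> equals \<open>- l (X + Y - l)\<close>, and a product of invertible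
operators is invertible.\<close>

lemma not_in_spectrum_add:
  assumes X: "bounded_clinear X" and Y: "bounded_clinear Y" and YX: "\<And>x. Y (X x) = 0"
    and l: "l \<noteq> 0" "l \<notin> op_spectrum X" "l \<notin> op_spectrum Y"
  shows "l \<notin> op_spectrum (\<lambda>x. X x + Y x)"
proof -
  obtain G where G: "bounded_clinear G" "\<And>x. G (X x - l *\<^sub>C x) = x" "\<And>x. X (G x) - l *\<^sub>C G x = x"
    using l(2) not_in_spectrumE by blast
  obtain H where H: "bounded_clinear H" "\<And>x. H (Y x - l *\<^sub>C x) = x" "\<And>x. Y (H x) - l *\<^sub>C H x = x"
    using l(3) not_in_spectrumE by blast
  have prod: "Y (X x - l *\<^sub>C x) - l *\<^sub>C (X x - l *\<^sub>C x) = - l *\<^sub>C (X x + Y x - l *\<^sub>C x)" for x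
    using bounded_clinear_diff[OF Y, of "X x" "l *\<^sub>C x"] bounded_clinear_scaleC[OF Y, of l x] YX
    by (simp add: complex_vector.scale_right_diff_distrib scaleC_add_right algebra_simps)
  have GH: "bounded_clinear (\<lambda>x. - l *\<^sub>C G (H x))"
    using bounded_clinear_scale[OF bounded_clinear_compose[OF G(1) H(1)], of "- l"] by (simp add: o_def)
  show ?thesis
  proof (rule not_in_spectrumI[OF GH])
    fix x
    have "- l *\<^sub>C G (H (X x + Y x - l *\<^sub>C x)) = G (H (- l *\<^sub>C (X x + Y x - l *\<^sub>C x)))"
      by (simp only: bounded_clinear_scaleC[OF H(1)] bounded_clinear_scaleC[OF G(1)])
    also have "\<dots> = x" by (simp only: prod[symmetric] H G)
    finally show "- l *\<^sub>C G (H (X x + Y x - l *\<^sub>C x)) = x" .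
    define z where "z = G (H x)"
    have "- l *\<^sub>C (X z + Y z - l *\<^sub>C z) = x"
      by (simp only: prod[symmetric] z_def G H)
    then show "X (- l *\<^sub>C G (H x)) + Y (- l *\<^sub>C G (H x)) - l *\<^sub>C (- l *\<^sub>C G (H x)) = x"
      unfolding z_def[symmetric] bounded_clinear_scaleC[OF X] bounded_clinear_scaleC[OF Y]
      by (simp add: complex_vector.scale_right_diff_distrib scaleC_add_right mult.commute)
  qed
qed

text \<open>\<open>(A - l) (A + l) = - l\<^sup>2\<close>.\<close>

lemma not_in_spectrum_square_zero:
  assumes A: "bounded_clinear A" and AA: "\<And>x. A (A x) = 0" and l: "l \<noteq> 0"
  shows "l \<notin> op_spectrum A"
proof (rule not_in_spectrumI)
  let ?B = "\<lambda>x. - (1 / l\<^sup>2) *\<^sub>C (A x + l *\<^sub>C x)"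
  show "bounded_clinear ?B"
    using bounded_clinear_scale[OF bounded_clinear_id, of l]
    by (intro bounded_clinear_scale[of "\<lambda>x. A x + l *\<^sub>C x"] bounded_clinear_plus A) simp
  have *: "- (1 / l\<^sup>2) *\<^sub>C - (l\<^sup>2 *\<^sub>C x) = x" for x :: 'a
    using l by (simp add: complex_vector.scale_minus_left complex_vector.scale_minus_right)
  have eq: "A (A x + l *\<^sub>C x) - l *\<^sub>C (A x + l *\<^sub>C x) = - (l\<^sup>2 *\<^sub>C x)"
    "A (A x - l *\<^sub>C x) + l *\<^sub>C (A x - l *\<^sub>C x) = - (l\<^sup>2 *\<^sub>C x)" for x
    by (simp_all add: bounded_clinear_add[OF A] bounded_clinear_diff[OF A] bounded_clinear_scaleC[OF A] AA
        scaleC_add_right complex_vector.scale_right_diff_distrib power2_eq_square)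
  show "?B (A x - l *\<^sub>C x) = x" for x
    by (simp only: eq *)
  show "A (?B x) - l *\<^sub>C ?B x = x" for x
  proof -
    have "A (?B x) - l *\<^sub>C ?B x = - (1 / l\<^sup>2) *\<^sub>C (A (A x + l *\<^sub>C x) - l *\<^sub>C (A x + l *\<^sub>C x))"
      by (simp only: bounded_clinear_scaleC[OF A] complex_vector.scale_right_diff_distrib
          complex_vector.scale_left_commute)
    then show ?thesis by (simp only: eq *)
  qed
qed

text \<open>Solving \<open>A x - l x = y\<close> means finding a fixed point of \<open>x \<mapsto> (A x - y) / l\<close>, which is a contraction; the
inverse is bounded because \<open>\<parallel>(A - l) x\<parallel> \<ge> (\<bar>l\<bar> - c) \<parallel>x\<parallel>\<close>.\<close>

lemma not_in_spectrum_of_norm_less: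
  assumes A: "bounded_clinear A" and c: "\<And>x. norm (A x) \<le> c * norm (x::'a::complex_hilbert)" "0 \<le> c" "c < cmod l"
  shows "l \<notin> op_spectrum A"
proof -
  have l: "l \<noteq> 0" using c by auto
  have ex: "\<exists>!x. A x - l *\<^sub>C x = y" for y
  proof -
    let ?g = "\<lambda>x. (1 / l) *\<^sub>C (A x - y)"
    have "\<exists>!x. ?g x = x"
    proof (rule banach_fix_type[where c = "c / cmod l"])
      show "\<forall>x z. dist (?g x) (?g z) \<le> c / cmod l * dist x z"
      proof (intro allI)
        fix x z
        have "dist (?g x) (?g z) = norm (A (x - z)) / cmod l"
          by (simp add: dist_norm complex_vector.scale_right_diff_distrib[symmetric]
              bounded_clinear_diff[OF A] norm_divide)
        also have "\<dots> \<le> c * norm (x - z) / cmod l" by (intro divide_right_mono c(1)) simp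
        finally show "dist (?g x) (?g z) \<le> c / cmod l * dist x z" by (simp add: dist_norm)
      qed
    qed (use c l in auto)
    moreover have "?g x = x \<longleftrightarrow> A x - l *\<^sub>C x = y" for x
    proof -
      have "?g x = x \<longleftrightarrow> l *\<^sub>C ?g x = l *\<^sub>C x" using l by (simp del: scaleC_scaleC)
      also have "l *\<^sub>C ?g x = A x - y" using l by (simp add: scaleC_scaleC scaleC_one)
      finally show ?thesis by (auto simp: algebra_simps)
    qed
    ultimately show ?thesis by simp
  qed
  define B where "B y = (THE x. A x - l *\<^sub>C x = y)" for y
  have AB: "A (B y) - l *\<^sub>C B y = y" for y
    unfolding B_def using theI'[OF ex[of y]] .
  have uniq: "B y = x" if "A x - l *\<^sub>C x = y" for x y
    using ex[of y] AB that by auto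
  show ?thesis
  proof (rule not_in_spectrumI)
    show "bounded_clinear B"
    proof (rule bounded_clinearI[where K = "1 / (cmod l - c)"])
      show "B (x + y) = B x + B y" for x y
      proof (rule uniq)
        have "A (B x + B y) - l *\<^sub>C (B x + B y) = (A (B x) - l *\<^sub>C B x) + (A (B y) - l *\<^sub>C B y)"
          by (simp add: bounded_clinear_add[OF A] scaleC_add_right)
        then show "A (B x + B y) - l *\<^sub>C (B x + B y) = x + y" by (simp only: AB)
      qed
      show "B (a *\<^sub>C x) = a *\<^sub>C B x" for a x
        by (rule uniq) (metis bounded_clinear_scaleC[OF A] complex_vector.scale_right_diff_distrib
            complex_vector.scale_left_commute AB)
      show "norm (B y) \<le> 1 / (cmod l - c) * norm y" for y
      proof -
        have "cmod l * norm (B y) = norm (A (B y) - y)"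
          using AB[of y] by (metis diff_diff_eq2 add_diff_cancel_left' norm_scaleC diff_add_cancel)
        also have "\<dots> \<le> c * norm (B y) + norm y"
          using norm_triangle_ineq4[of "A (B y)" y] c(1)[of "B y"] by linarith
        finally have "(cmod l - c) * norm (B y) \<le> norm y" by (simp add: algebra_simps)
        then show ?thesis using c(3) by (simp add: field_simps)
      qed
    qed
  qed (simp_all add: AB uniq)
qed

section \<open>Orthogonality and orthonormal bases\<close>

lemma cinner_eq_zero_cspan:
  assumes "\<And>s. s \<in> S \<Longrightarrow> cinner x s = 0" "y \<in> cspan S"
  shows "cinner x y = 0"
  using assms(2)
  by (induction rule: complex_vector.span_induct_alt) (simp_all add: assms(1) cinner_add_right)

text \<open>By induction on \<open>S\<close>: a new vector \<open>s\<close> is replaced by its component \<open>e\<close> orthogonal to the earlier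
vectors, and the coefficient of \<open>e\<close> is then determined. If \<open>e = 0\<close>, then \<open>s\<close> already lies in
the span of \<open>S\<close>, and division by zero gives the coefficient \<open>0\<close>.\<close>

lemma ex_orthogonal_projection:
  assumes "finite S"
  shows "\<exists>y\<in>cspan S. \<forall>s\<in>S. cinner (x - y) s = (0::complex)"
  using assms
proof (induction S arbitrary: x rule: finite_induct)
  case empty
  then show ?case by simp
next
  case (insert s S)
  obtain z where z: "z \<in> cspan S" "\<And>t. t \<in> S \<Longrightarrow> cinner (s - z) t = 0" using insert.IH[of s] by blast
  obtain y where y: "y \<in> cspan S" "\<And>t. t \<in> S \<Longrightarrow> cinner (x - y) t = 0" using insert.IH[of x] by blast
  define e where "e = s - z"
  define c where "c = cinner (x - y) e / cinner e e"
  have in_span: "w \<in> cspan (insert s S)" if "w \<in> cspan S" for w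
    using that complex_vector.span_mono[of S "insert s S"] by auto
  have e: "e \<in> cspan (insert s S)"
    unfolding e_def by (intro complex_vector.span_diff in_span z complex_vector.span_base) simp
  have "cinner (x - (y + c *\<^sub>C e)) t = 0" if "t \<in> insert s S" for t
  proof -
    have S: "cinner (x - (y + c *\<^sub>C e)) t = 0" if "t \<in> S" for t
      using y(2)[OF that] z(2)[OF that]
      by (simp add: cinner_diff_left cinner_add_left e_def[symmetric])
    have "c * cinner e e = cinner (x - y) e"
    proof (cases "e = 0")
      case False
      then have "cinner e e \<noteq> 0" using norm_sq_eq_cinner[of e] by (metis norm_eq_zero of_real_eq_0_iff zero_eq_power2)
      then show ?thesis by (simp add: c_def)
    qed simp
    then have "cinner (x - (y + c *\<^sub>C e)) e = 0"
      by (simp add: cinner_diff_left cinner_add_left)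
    moreover have "cinner (x - (y + c *\<^sub>C e)) z = 0"
      using S z(1) by (rule cinner_eq_zero_cspan)
    moreover have "s = e + z" by (simp add: e_def)
    ultimately have "cinner (x - (y + c *\<^sub>C e)) s = 0" by (simp add: cinner_add_right)
    then show ?thesis using S that by blast
  qed
  then show ?case
    using complex_vector.span_add[OF in_span[OF y(1)] complex_vector.span_scale[OF e]] by blast
qed

text \<open>One step of the Gram-Schmidt process.\<close>

lemma ex_unit_orthogonal:
  assumes "finite S" "x \<notin> cspan S"
  shows "\<exists>u. norm u = 1 \<and> (\<forall>s\<in>S. cinner u s = (0::complex)) \<and>
    x \<in> cspan (insert u S) \<and> u \<in> cspan (insert x S)"
proof -
  obtain y where y: "y \<in> cspan S" "\<And>s. s \<in> S \<Longrightarrow> cinner (x - y) s = 0"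
    using ex_orthogonal_projection[OF assms(1), of x] by blast
  define r where "r = complex_of_real (norm (x - y))"
  define u where "u = (1 / r) *\<^sub>C (x - y)"
  have "x \<noteq> y" using y assms by auto
  then have r: "r \<noteq> 0" by (simp add: r_def)
  have in_span: "y \<in> cspan (insert w S)" for w
    using y(1) complex_vector.span_mono[of S "insert w S"] by auto
  have "norm u = 1" using \<open>x \<noteq> y\<close> by (simp add: u_def r_def norm_divide)
  moreover have "\<forall>s\<in>S. cinner u s = 0" using y by (simp add: u_def)
  moreover have "x = r *\<^sub>C u + y" using r by (simp add: u_def scaleC_scaleC scaleC_one)
  then have "x \<in> cspan (insert u S)"
    by (metis in_span complex_vector.span_add complex_vector.span_scale complex_vector.span_base insertI1)
  moreover have "u \<in> cspan (insert x S)"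
    unfolding u_def
    by (intro complex_vector.span_scale complex_vector.span_diff in_span complex_vector.span_base) simp
  ultimately show ?thesis by blast
qed

locale hilbert_basis =
  fixes f :: "nat \<Rightarrow> 'a::complex_hilbert"
  assumes basis: "orthonormal_basis f"
begin

lemma cinner_basis [simp]: "cinner (f i) (f j) = (if i = j then 1 else 0)"
  using basis by (simp add: orthonormal_basis_def)

lemma norm_basis [simp]: "norm (f i) = 1"
  by (simp add: norm_eq_sqrt_cinner)

lemma norm_sum_basis_sq:
  "finite I \<Longrightarrow> (norm (\<Sum>i\<in>I. a i *\<^sub>C f i))\<^sup>2 = (\<Sum>i\<in>I. (cmod (a i))\<^sup>2)"
proof -
  assume I: "finite I"
  have "cinner (f i) (\<Sum>j\<in>I. a j *\<^sub>C f j) = cnj (a i)" if "i \<in> I" for i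
    using I that by (simp add: cinner_sum_right sum.delta if_distrib[of "\<lambda>z. _ * z"] cong: if_cong)
  then have "complex_of_real ((norm (\<Sum>i\<in>I. a i *\<^sub>C f i))\<^sup>2) = (\<Sum>i\<in>I. a i * cnj (a i))"
    by (simp only: norm_sq_eq_cinner cinner_sum_left cinner_scaleC_left cong: sum.cong)
  also have "\<dots> = complex_of_real (\<Sum>i\<in>I. (cmod (a i))\<^sup>2)"
    by (simp add: complex_norm_square[symmetric])
  finally show ?thesis by (simp only: of_real_eq_iff)
qed

text \<open>The orthogonal projection onto the closed span of \<open>f n, f (n + 1), \<dots>\<close>.\<close>

definition tail :: "nat \<Rightarrow> 'a \<Rightarrow> 'a" where
  "tail n x = x - (\<Sum>i<n. cinner x (f i) *\<^sub>C f i)"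

lemma tail_0 [simp]: "tail 0 x = x"
  by (simp add: tail_def)

lemma tail_Suc: "tail n x = cinner x (f n) *\<^sub>C f n + tail (Suc n) x"
  by (simp add: tail_def)

lemma cinner_sum_basis:
  "finite I \<Longrightarrow> cinner (\<Sum>i\<in>I. a i *\<^sub>C f i) (f k) = (if k \<in> I then a k else 0)"
  by (simp add: cinner_sum_left sum.delta if_distrib[of "\<lambda>z. _ * z"] cong: if_cong)

lemma cinner_tail: "cinner (tail n x) (f k) = (if k < n then 0 else cinner x (f k))"
  by (simp add: tail_def cinner_diff_left cinner_sum_basis)

lemma norm_sq_tail: "(norm x)\<^sup>2 = (\<Sum>i<n. (cmod (cinner x (f i)))\<^sup>2) + (norm (tail n x))\<^sup>2"
proof -
  have "cinner (\<Sum>i<n. cinner x (f i) *\<^sub>C f i) (tail n x) = 0"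
    using cinner_tail[of n x]
    by (simp add: cinner_sum_left cinner_commute[of "f _" "tail n x"])
  from norm_add_sq_of_orthogonal[OF this] show ?thesis
    by (simp add: norm_sum_basis_sq) (simp add: tail_def)
qed

lemma norm_tail_le: "norm (tail n x) \<le> norm x"
proof -
  have "(norm (tail n x))\<^sup>2 \<le> (norm x)\<^sup>2"
    unfolding norm_sq_tail[of x n] by (simp add: sum_nonneg)
  then show ?thesis by (simp add: power2_le_iff_abs_le)
qed

lemma bessel: "finite I \<Longrightarrow> (\<Sum>i\<in>I. (cmod (cinner x (f i)))\<^sup>2) \<le> (norm x)\<^sup>2"
proof -
  assume "finite I"
  then obtain n where n: "I \<subseteq> {..<n}" using finite_nat_iff_bounded by blast
  have "(\<Sum>i\<in>I. (cmod (cinner x (f i)))\<^sup>2) \<le> (\<Sum>i<n. (cmod (cinner x (f i)))\<^sup>2)"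
    using n by (intro sum_mono2) auto
  also have "\<dots> \<le> (norm x)\<^sup>2" unfolding norm_sq_tail[of x n] by simp
  finally show ?thesis .
qed

lemma tail_add: "tail n (x + y) = tail n x + tail n y"
  by (simp add: tail_def cinner_add_left scaleC_add_left sum.distrib)

lemma tail_diff: "tail n (x - y) = tail n x - tail n y"
  using tail_add[of n "x - y" y] by simp

lemma tail_scaleC: "tail n (c *\<^sub>C x) = c *\<^sub>C tail n x"
  by (simp add: tail_def complex_vector.scale_right_diff_distrib complex_vector.scale_sum_right scaleC_scaleC)

lemma bounded_clinear_tail: "bounded_clinear (tail n)"
  using norm_tail_le by (intro bounded_clinearI[where K = 1]) (auto simp: tail_add tail_scaleC)

lemma tail_basis: "tail n (f j) = (if j < n then 0 else f j)"
proof -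
  have "(\<Sum>i<n. cinner (f j) (f i) *\<^sub>C f i) = (\<Sum>i<n. if i = j then f i else 0)"
    by (intro sum.cong) (auto simp: scaleC_one)
  then show ?thesis by (simp add: tail_def)
qed

text \<open>On a finite combination of basis vectors the tails are eventually \<open>0\<close>. Such combinations are dense, and
tails do not increase norms.\<close>

lemma tail_tendsto_0: "(\<lambda>n. tail n x) \<longlonglongrightarrow> 0"
proof (rule LIMSEQ_I)
  fix e :: real assume "0 < e"
  have "x \<in> closure (cspan (range f))" using basis by (simp add: orthonormal_basis_def)
  then obtain z where z: "z \<in> cspan (range f)" "dist z x < e"
    using \<open>0 < e\<close> closure_approachable by blast
  have "\<exists>N. \<forall>n\<ge>N. tail n z = 0"
    using z(1)
  proof (induction rule: complex_vector.span_induct_alt)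
    case base
    then show ?case using tail_diff[of _ 0 0] by simp
  next
    case (step c b y)
    then obtain i N where "b = f i" "\<forall>n\<ge>N. tail n y = 0" by blast
    then have "\<forall>n\<ge>max N (Suc i). tail n (c *\<^sub>C b + y) = 0"
      by (simp add: tail_add tail_scaleC tail_basis)
    then show ?case by blast
  qed
  then obtain N where N: "\<And>n. n \<ge> N \<Longrightarrow> tail n z = 0" by blast
  have "norm (tail n x - 0) < e" if "n \<ge> N" for n
  proof -
    have "tail n x = tail n (x - z)" using N[OF that] by (simp add: tail_diff)
    then show ?thesis using norm_tail_le[of n "x - z"] z(2) by (simp add: dist_norm norm_minus_commute)
  qed
  then show "\<exists>N. \<forall>n\<ge>N. norm (tail n x - 0) < e" by blast
qed

lemma basis_sums: "(\<lambda>i. cinner x (f i) *\<^sub>C f i) sums x"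
  using tendsto_diff[OF tendsto_const[of x] tail_tendsto_0[of x]]
  by (simp add: sums_def tail_def)

lemma eq_by_coordinates:
  assumes "\<And>i. cinner x (f i) = cinner y (f i)"
  shows "x = y"
  using basis_sums[of x] basis_sums[of y] assms sums_unique2 by simp

lemma image_sums:
  assumes "bounded_clinear A"
  shows "(\<lambda>j. cinner x (f j) *\<^sub>C A (f j)) sums A x"
proof -
  have "bounded_linear A" using assms by (simp add: bounded_clinear_def)
  from bounded_linear.sums[OF this basis_sums[of x]] show ?thesis
    by (simp add: bounded_clinear_scaleC[OF assms])
qed

lemma coordinate_sums:
  assumes "bounded_clinear A"
  shows "(\<lambda>j. entry f A i j * cinner x (f j)) sums cinner (A x) (f i)"
  using bounded_linear.sums[OF bounded_linear_cinner_left image_sums[OF assms, of x], of "f i"]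
  by (simp add: entry_def mult.commute)

lemma eq_by_entries:
  assumes "bounded_clinear A" "bounded_clinear B" "\<And>i j. entry f A i j = entry f B i j"
  shows "A = B"
proof (rule ext, rule eq_by_coordinates)
  fix x i
  show "cinner (A x) (f i) = cinner (B x) (f i)"
    using coordinate_sums[OF assms(1), of i x] coordinate_sums[OF assms(2), of i x] assms(3) sums_unique2
    by simp
qed

lemma op_of_matrix_eq:
  assumes "bounded_clinear A" "\<And>i j. entry f A i j = M i j"
  shows "op_of_matrix f M = A"
proof
  fix x
  have "(\<Sum>j. M i j * cinner x (f j)) = cinner (A x) (f i)" for i
    using sums_unique[OF coordinate_sums[OF assms(1), of i x]] assms(2) by simp
  then show "op_of_matrix f M x = A x"
    using sums_unique[OF basis_sums[of "A x"]] by (simp add: op_of_matrix_def)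
qed

text \<open>The Riesz-Fischer theorem: completeness of the space turns square summable coordinates into a vector.\<close>

lemma ex_of_coordinates:
  assumes "\<And>n. (\<Sum>i<n. (cmod (a i))\<^sup>2) \<le> C\<^sup>2" "0 \<le> C"
  shows "\<exists>x. (\<forall>i. cinner x (f i) = a i) \<and> norm x \<le> C"
proof -
  let ?s = "\<lambda>n. \<Sum>i<n. (cmod (a i))\<^sup>2"
  have "summable (\<lambda>i. (cmod (a i))\<^sup>2)"
    by (rule summableI_nonneg_bounded[where x = "C\<^sup>2"]) (simp_all add: assms)
  then have cau: "Cauchy ?s" by (simp add: summable_iff_convergent LIMSEQ_imp_Cauchy convergent_LIMSEQ_iff)
  have diff: "(norm ((\<Sum>i<m. a i *\<^sub>C f i) - (\<Sum>i<n. a i *\<^sub>C f i)))\<^sup>2 = ?s m - ?s n" if "n \<le> m" for m n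
  proof -
    have "{..<m} = {..<n} \<union> {n..<m}" using that by auto
    then have split: "sum g {..<m} = sum g {..<n} + sum g {n..<m}" for g :: "nat \<Rightarrow> 'b::comm_monoid_add"
      by (simp add: sum.union_disjoint ivl_disj_int)
    show ?thesis by (simp add: split norm_sum_basis_sq)
  qed
  have "Cauchy (\<lambda>n. \<Sum>i<n. a i *\<^sub>C f i)"
  proof (rule metric_CauchyI)
    fix e :: real assume "0 < e"
    then obtain M where M: "\<And>m n. m \<ge> M \<Longrightarrow> n \<ge> M \<Longrightarrow> dist (?s m) (?s n) < e\<^sup>2"
      using metric_CauchyD[OF cau, of "e\<^sup>2"] by auto
    have le: "dist (\<Sum>i<m. a i *\<^sub>C f i) (\<Sum>i<n. a i *\<^sub>C f i) < e" if "n \<ge> M" "n \<le> m" for m n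
    proof -
      have "(norm ((\<Sum>i<m. a i *\<^sub>C f i) - (\<Sum>i<n. a i *\<^sub>C f i)))\<^sup>2 < e\<^sup>2"
        using M[of m n] that by (simp add: diff dist_real_def)
      then show ?thesis using \<open>0 < e\<close> by (simp add: dist_norm power2_less_imp_less)
    qed
    show "\<exists>M. \<forall>m\<ge>M. \<forall>n\<ge>M. dist (\<Sum>i<m. a i *\<^sub>C f i) (\<Sum>i<n. a i *\<^sub>C f i) < e"
      using le by (metis dist_commute nle_le)
  qed
  then obtain x where x: "(\<lambda>n. \<Sum>i<n. a i *\<^sub>C f i) \<longlonglongrightarrow> x" using Cauchy_convergent_iff convergent_def by blast
  have "cinner x (f k) = a k" for k
  proof -
    have "(\<lambda>n. cinner (\<Sum>i<n. a i *\<^sub>C f i) (f k)) \<longlonglongrightarrow> cinner x (f k)"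
      by (rule bounded_linear.tendsto[OF bounded_linear_cinner_left x])
    moreover have "(\<lambda>n. cinner (\<Sum>i<n. a i *\<^sub>C f i) (f k)) \<longlonglongrightarrow> a k"
      by (rule tendsto_eventually, rule eventually_sequentiallyI[of "Suc k"]) (simp add: cinner_sum_basis)
    ultimately show ?thesis using LIMSEQ_unique by blast
  qed
  moreover have "norm x \<le> C"
  proof (rule LIMSEQ_le_const2[OF tendsto_norm[OF x]], intro exI allI impI)
    show "norm (\<Sum>i<n. a i *\<^sub>C f i) \<le> C" for n
      by (rule power2_le_imp_le) (simp_all add: norm_sum_basis_sq assms)
  qed
  ultimately show ?thesis by blast
qed

text \<open>The vectors with the prescribed coordinates depend linearly on \<open>x\<close> because the coordinates do and they
determine a vector.\<close>

lemma ex_operator_of_coordinates: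
  assumes "\<And>x n. (\<Sum>i<n. (cmod (Y x i))\<^sup>2) \<le> (C * norm x)\<^sup>2" "0 \<le> C"
    and "\<And>x y i. Y (x + y) i = Y x i + Y y i" "\<And>c x i. Y (c *\<^sub>C x) i = c * Y x i"
  shows "\<exists>A. bounded_clinear A \<and> (\<forall>x i. cinner (A x) (f i) = Y x i) \<and> (\<forall>x. norm (A x) \<le> C * norm x)"
proof -
  have "\<forall>x. \<exists>z. (\<forall>i. cinner z (f i) = Y x i) \<and> norm z \<le> C * norm x"
    using ex_of_coordinates assms(1,2) by simp
  then obtain A where A: "\<And>x i. cinner (A x) (f i) = Y x i" "\<And>x. norm (A x) \<le> C * norm x" by metis
  have "bounded_clinear A"
    by (rule bounded_clinearI[OF _ _ A(2)]; rule eq_by_coordinates)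
      (simp_all add: A(1) cinner_add_left assms)
  with A show ?thesis by blast
qed

section \<open>Adjoints and unitary operators\<close>

text \<open>The coordinates of \<open>A\<^sup>* y\<close> must be \<open>\<langle>y, A f\<^sub>i\<rangle>\<close>. They are square summable: if \<open>z\<close> is the combination
of the first \<open>n\<close> basis vectors with these coefficients, then \<open>\<parallel>z\<parallel>\<^sup>2 = \<langle>y, A z\<rangle> \<le> \<parallel>y\<parallel> C \<parallel>z\<parallel>\<close>, so
\<open>\<parallel>z\<parallel> \<le> C \<parallel>y\<parallel>\<close>.\<close>

lemma ex_adjoint:
  fixes A :: "'a \<Rightarrow> 'a"
  assumes A: "bounded_clinear A"
  shows "\<exists>B. bounded_clinear B \<and> (\<forall>x y. cinner (A x) y = cinner x (B y))"
proof -
  obtain C where C: "C \<ge> 0" "\<And>x. norm (A x) \<le> C * norm x" using bounded_clinear_bound[OF A] by blast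
  have bound: "(\<Sum>i<n. (cmod (cinner y (A (f i))))\<^sup>2) \<le> (C * norm y)\<^sup>2" for y n
  proof -
    let ?z = "\<Sum>i<n. cinner y (A (f i)) *\<^sub>C f i"
    have "complex_of_real ((norm ?z)\<^sup>2) = (\<Sum>i<n. cinner y (A (f i)) * cnj (cinner y (A (f i))))"
      by (simp add: norm_sum_basis_sq complex_norm_square[symmetric])
    also have "\<dots> = cinner y (A ?z)"
      by (simp add: bounded_clinear_sum[OF A] bounded_clinear_scaleC[OF A] cinner_sum_right mult.commute)
    finally have "(norm ?z)\<^sup>2 = cmod (cinner y (A ?z))" by (metis norm_of_real abs_power2)
    also have "\<dots> \<le> norm y * (C * norm ?z)"
      using norm_cinner_le[of y "A ?z"] mult_left_mono[OF C(2)[of ?z], of "norm y"] by simp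
    finally have "norm ?z * norm ?z \<le> (C * norm y) * norm ?z" by (simp add: power2_eq_square mult_ac)
    then have "norm ?z \<le> C * norm y"
      using C(1) by (cases "norm ?z = 0") (auto simp: mult_le_cancel_right)
    then have "(norm ?z)\<^sup>2 \<le> (C * norm y)\<^sup>2" by (simp add: power_mono)
    then show ?thesis by (simp add: norm_sum_basis_sq)
  qed
  obtain B where B: "bounded_clinear B" "\<And>y i. cinner (B y) (f i) = cinner y (A (f i))"
    using ex_operator_of_coordinates[where Y = "\<lambda>y i. cinner y (A (f i))", OF bound C(1)]
    by (auto simp: cinner_add_left)
  have "cinner (A x) y = cinner x (B y)" for x y
  proof -
    have "(\<lambda>j. cinner (cinner x (f j) *\<^sub>C A (f j)) y) sums cinner (A x) y"
      by (rule bounded_linear.sums[OF bounded_linear_cinner_left image_sums[OF A]])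
    moreover have "(\<lambda>j. cinner (cinner x (f j) *\<^sub>C f j) (B y)) sums cinner x (B y)"
      by (rule bounded_linear.sums[OF bounded_linear_cinner_left basis_sums])
    moreover have "cinner (A (f j)) y = cinner (f j) (B y)" for j
      by (metis B(2) cinner_commute)
    ultimately show ?thesis using sums_unique2 by simp
  qed
  with B(1) show ?thesis by blast
qed

lemma
  fixes A :: "'a \<Rightarrow> 'a"
  assumes A: "bounded_clinear A"
  shows cinner_cadjoint: "cinner (A x) y = cinner x (cadjoint A y)"
    and cadjoint_eqI: "(\<And>x y. cinner (A x) y = cinner x (B y)) \<Longrightarrow> cadjoint A = B"
    and bounded_clinear_cadjoint: "bounded_clinear (cadjoint A)"
proof -
  obtain B' where B': "bounded_clinear B'" "\<And>x y. cinner (A x) y = cinner x (B' y)"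
    using ex_adjoint[OF A] by blast
  have adj: "cinner (A x) y = cinner x (cadjoint A y)" for x y
    unfolding cadjoint_def
    by (rule someI2_ex[where Q = "\<lambda>B. cinner (A x) y = cinner x (B y)"]) (use B' in blast)+
  then show "cinner (A x) y = cinner x (cadjoint A y)" .
  have eq: "cadjoint A = B" if "\<And>x y. cinner (A x) y = cinner x (B y)" for B
  proof (rule ext, rule eq_by_coordinates)
    fix y i
    have "cinner (f i) (cadjoint A y) = cinner (f i) (B y)" by (metis that adj)
    then show "cinner (cadjoint A y) (f i) = cinner (B y) (f i)" by (metis cinner_commute)
  qed
  then show "(\<And>x y. cinner (A x) y = cinner x (B y)) \<Longrightarrow> cadjoint A = B" .
  show "bounded_clinear (cadjoint A)"
    using eq[OF B'(2)] B'(1) by simp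
qed

lemma entry_cadjoint: "bounded_clinear A \<Longrightarrow> entry f (cadjoint A) i j = cnj (entry f A j i)"
  by (metis cinner_cadjoint cinner_commute entry_def)

lemma cadjoint_eq_by_entries:
  fixes A B :: "'a \<Rightarrow> 'a"
  assumes "bounded_clinear A" "bounded_clinear B" "\<And>i j. entry f B i j = cnj (entry f A j i)"
  shows "cadjoint A = B"
  using assms by (intro eq_by_entries bounded_clinear_cadjoint) (simp_all add: entry_cadjoint)

lemma cadjoint_compose:
  fixes A B :: "'a \<Rightarrow> 'a"
  assumes "bounded_clinear A" "bounded_clinear B"
  shows "cadjoint (A \<circ> B) = cadjoint B \<circ> cadjoint A"
  by (rule cadjoint_eqI) (simp_all add: assms bounded_clinear_compose cinner_cadjoint)

lemma cadjoint_id: "cadjoint (id :: 'a \<Rightarrow> 'a) = id"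
  by (rule cadjoint_eqI) (simp_all add: bounded_clinear_id)

lemma unitary_op_id: "unitary_op (id :: 'a \<Rightarrow> 'a)"
  by (simp add: unitary_op_def bounded_clinear_id cadjoint_id)

lemma unitary_op_compose:
  fixes V W :: "'a \<Rightarrow> 'a"
  assumes "unitary_op V" "unitary_op W" shows "unitary_op (V \<circ> W)"
proof -
  have V: "bounded_clinear V" "\<And>x. cadjoint V (V x) = x" "\<And>x. V (cadjoint V x) = x"
    and W: "bounded_clinear W" "\<And>x. cadjoint W (W x) = x" "\<And>x. W (cadjoint W x) = x"
    using assms by (auto simp: unitary_op_def fun_eq_iff)
  then show ?thesis
    by (simp add: unitary_op_def cadjoint_compose bounded_clinear_compose fun_eq_iff)
qed

lemma conj_op_compose:
  fixes V W :: "'a \<Rightarrow> 'a"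
  assumes "bounded_clinear V" "bounded_clinear W"
  shows "conj_op (V \<circ> W) A = conj_op W (conj_op V A)"
  using assms by (simp add: conj_op_def cadjoint_compose o_assoc)

lemma conj_op_id: "conj_op id A = (A :: 'a \<Rightarrow> 'a)"
  by (simp add: conj_op_def cadjoint_id)

lemma entry_conj_op:
  "bounded_clinear V \<Longrightarrow> entry f (conj_op V A) i j = cinner (A (V (f j))) (V (f i))"
  by (simp add: entry_def conj_op_def) (metis cinner_cadjoint cinner_commute)

section \<open>Compactness in terms of tails\<close>

text \<open>The tails tend to \<open>0\<close> at every point, and uniformly on the image of the unit ball because that image is
covered by finitely many small balls.\<close>

lemma compact_op_tail:
  assumes A: "compact_op A" and "0 < e"
  shows "\<exists>n. \<forall>x. norm (tail n (A x)) \<le> e * norm x"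
proof -
  have lin: "bounded_clinear A" and comp: "compact (closure (A ` cball 0 1))"
    using A by (auto simp: compact_op_def)
  obtain K where K: "finite K" "closure (A ` cball 0 1) \<subseteq> (\<Union>c\<in>K. ball c (e / 2))"
    using comp \<open>0 < e\<close> unfolding compact_eq_totally_bounded by (metis half_gt_zero)
  have "\<forall>\<^sub>F n in sequentially. norm (tail n c) < e / 2" for c
    using order_tendstoD(2)[OF tendsto_norm_zero[OF tail_tendsto_0[of c]], of "e / 2"] \<open>0 < e\<close>
    by simp
  then have "\<forall>\<^sub>F n in sequentially. \<forall>c\<in>K. norm (tail n c) < e / 2"
    using K(1) by (simp add: eventually_ball_finite)
  then obtain n where n: "\<And>c. c \<in> K \<Longrightarrow> norm (tail n c) < e / 2"
    by (auto simp: eventually_sequentially)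
  have unit: "norm (tail n (A x)) \<le> e" if "norm x \<le> 1" for x
  proof -
    have "A x \<in> closure (A ` cball 0 1)" using that closure_subset by fastforce
    then obtain c where c: "c \<in> K" "dist c (A x) < e / 2" using K(2) by auto
    have "tail n (A x) = tail n c + tail n (A x - c)" by (simp add: tail_diff)
    then have "norm (tail n (A x)) \<le> norm (tail n c) + norm (A x - c)"
      using norm_triangle_ineq[of "tail n c" "tail n (A x - c)"] norm_tail_le[of n "A x - c"] by simp
    then show ?thesis using n[OF c(1)] c(2) by (simp add: dist_norm norm_minus_commute)
  qed
  have "norm (tail n (A x)) \<le> e * norm x" for x
  proof (cases "x = 0")
    case True
    then show ?thesis by (simp add: bounded_clinear_zero[OF lin] bounded_clinear_zero[OF bounded_clinear_tail])
  next
    case False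
    define c where "c = complex_of_real (norm x)"
    define u where "u = (1 / c) *\<^sub>C x"
    have c: "c \<noteq> 0" using False by (simp add: c_def)
    have u: "x = c *\<^sub>C u" using c by (simp add: u_def scaleC_scaleC scaleC_one)
    have "norm u \<le> 1" using False by (simp add: u_def c_def norm_divide)
    from unit[OF this] have "norm x * norm (tail n (A u)) \<le> norm x * e" by (simp add: mult_left_mono)
    moreover have "norm (tail n (A x)) = norm x * norm (tail n (A u))"
      by (subst u) (simp add: bounded_clinear_scaleC[OF lin] tail_scaleC c_def)
    ultimately show ?thesis by (simp add: mult.commute)
  qed
  then show ?thesis by blast
qed

lemma compact_coordinate_box: "compact {\<Sum>i<n. a i *\<^sub>C f i | a. \<forall>i<n. cmod (a i) \<le> C}"
proof (induction n)
  case 0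
  then show ?case by simp
next
  case (Suc n)
  let ?S = "\<lambda>n. {\<Sum>i<n. a i *\<^sub>C f i | a. \<forall>i<n. cmod (a i) \<le> C}"
  have "compact ((\<lambda>a. a *\<^sub>C f n) ` cball 0 C)"
    by (intro compact_continuous_image linear_continuous_on bounded_linear_scaleC_left compact_cball)
  from compact_sums[OF Suc this]
  have "compact {x + y |x y. x \<in> ?S n \<and> y \<in> (\<lambda>a. a *\<^sub>C f n) ` cball 0 C}" .
  also have "{x + y |x y. x \<in> ?S n \<and> y \<in> (\<lambda>a. a *\<^sub>C f n) ` cball 0 C} = ?S (Suc n)" (is "?L = ?R")
  proof
    show "?R \<subseteq> ?L"
    proof
      fix z assume "z \<in> ?R"
      then obtain a where a: "z = (\<Sum>i<Suc n. a i *\<^sub>C f i)" "\<forall>i<Suc n. cmod (a i) \<le> C" by blast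
      have 1: "(\<Sum>i<n. a i *\<^sub>C f i) \<in> ?S n" using a(2) by (intro CollectI exI[of _ a]) simp
      have 2: "a n *\<^sub>C f n \<in> (\<lambda>a. a *\<^sub>C f n) ` cball 0 C" using a(2) by (intro imageI) simp
      have 3: "z = (\<Sum>i<n. a i *\<^sub>C f i) + a n *\<^sub>C f n" using a(1) by simp
      show "z \<in> ?L"
        by (rule CollectI, rule exI[of _ "\<Sum>i<n. a i *\<^sub>C f i"], rule exI[of _ "a n *\<^sub>C f n"], intro conjI 3 1 2)
    qed
    show "?L \<subseteq> ?R"
    proof
      fix z assume "z \<in> ?L"
      then obtain x y where xy: "z = x + y" "x \<in> ?S n" "y \<in> (\<lambda>a. a *\<^sub>C f n) ` cball 0 C" by blast
      from xy(2) obtain a where a: "x = (\<Sum>i<n. a i *\<^sub>C f i)" "\<forall>i<n. cmod (a i) \<le> C" by blast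
      from xy(3) obtain b where "y = b *\<^sub>C f n" "b \<in> cball 0 C" by (rule imageE)
      then have b: "y = b *\<^sub>C f n" "cmod b \<le> C" by simp_all
      have ab: "z = (\<Sum>i<n. a i *\<^sub>C f i) + b *\<^sub>C f n" "\<forall>i<n. cmod (a i) \<le> C" "cmod b \<le> C"
        using xy(1) a b by simp_all
      have "z = (\<Sum>i<Suc n. (a(n := b)) i *\<^sub>C f i)" unfolding ab(1) by simp
      moreover have "\<forall>i<Suc n. cmod ((a(n := b)) i) \<le> C" using ab by auto
      ultimately show "z \<in> ?R" by (intro CollectI exI[of _ "a(n := b)"] conjI)
    qed
  qed
  finally show ?case .
qed

text \<open>The converse: up to an error \<open>e\<close> the image of the unit ball lies in a bounded set of combinations of
finitely many basis vectors, so it is totally bounded.\<close>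

lemma compact_opI:
  assumes lin: "bounded_clinear A" and tails: "\<And>e. 0 < e \<Longrightarrow> \<exists>n. \<forall>x. norm (tail n (A x)) \<le> e * norm x"
  shows "compact_op A"
proof -
  obtain C where C: "C \<ge> 0" "\<And>x. norm (A x) \<le> C * norm x" using bounded_clinear_bound[OF lin] by blast
  have "\<exists>K. finite K \<and> closure (A ` cball 0 1) \<subseteq> (\<Union>c\<in>K. ball c e)" if "0 < e" for e
  proof -
    obtain n where n: "\<And>x. norm (tail n (A x)) \<le> e / 4 * norm x" using tails[of "e / 4"] \<open>0 < e\<close> by auto
    let ?S = "{\<Sum>i<n. a i *\<^sub>C f i | a. \<forall>i<n. cmod (a i) \<le> C}"
    obtain K where K: "finite K" "?S \<subseteq> (\<Union>c\<in>K. ball c (e / 4))"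
      using compact_coordinate_box[of n C, unfolded compact_eq_totally_bounded, THEN conjunct2, rule_format, of "e / 4"]
        \<open>0 < e\<close> by auto
    have near: "\<exists>c\<in>K. dist c (A x) \<le> e / 2" if "norm x \<le> 1" for x
    proof -
      have "cmod (cinner (A x) (f i)) \<le> C" for i
      proof -
        have "C * norm x \<le> C" using C(1) that by (simp add: mult_left_le)
        then show ?thesis using norm_cinner_le[of "A x" "f i"] C(2)[of x] by simp
      qed
      then have "(\<Sum>i<n. cinner (A x) (f i) *\<^sub>C f i) \<in> ?S"
        by (intro CollectI exI[of _ "\<lambda>i. cinner (A x) (f i)"]) simp
      then obtain c where c: "c \<in> K" "dist c (\<Sum>i<n. cinner (A x) (f i) *\<^sub>C f i) < e / 4" using K(2) by auto
      have "e / 4 * norm x \<le> e / 4" using \<open>0 < e\<close> that by (simp add: mult_left_le)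
      then have "norm (tail n (A x)) \<le> e / 4" using n[of x] by simp
      then have "dist (\<Sum>i<n. cinner (A x) (f i) *\<^sub>C f i) (A x) \<le> e / 4"
        by (simp add: tail_def dist_norm norm_minus_commute)
      then have "dist c (A x) \<le> e / 2" using c(2) dist_triangle[of c "A x" "\<Sum>i<n. cinner (A x) (f i) *\<^sub>C f i"] by linarith
      with c(1) show ?thesis by blast
    qed
    \<comment> \<open>The slack between \<open>e / 2\<close> and \<open>e\<close> allows closed balls, which also cover the closure.\<close>
    have "closure (A ` cball 0 1) \<subseteq> (\<Union>c\<in>K. cball c (e / 2))"
      using near K(1) by (intro closure_minimal closed_UN) auto
    also have "\<dots> \<subseteq> (\<Union>c\<in>K. ball c e)" using \<open>0 < e\<close> by force
    finally show ?thesis using K(1) by blast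
  qed
  then have "compact (closure (A ` cball 0 1))"
    unfolding compact_eq_totally_bounded by (simp add: complete_eq_closed)
  with lin show ?thesis by (simp add: compact_op_def)
qed

lemma compact_op_add:
  fixes A B :: "'a \<Rightarrow> 'a"
  assumes "compact_op A" "compact_op B"
  shows "compact_op (\<lambda>x. A x + B x)"
proof (rule compact_opI)
  show "bounded_clinear (\<lambda>x. A x + B x)"
    using assms by (intro bounded_clinear_plus) (auto simp: compact_op_def)
  fix e :: real assume "0 < e"
  then obtain m n where m: "\<And>x. norm (tail m (A x)) \<le> e / 2 * norm x" and n: "\<And>x. norm (tail n (B x)) \<le> e / 2 * norm x"
    using compact_op_tail[OF assms(1), of "e / 2"] compact_op_tail[OF assms(2), of "e / 2"] by auto
  have mono: "norm (tail k x) \<le> norm (tail j x)" if "j \<le> k" for j k x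
  proof -
    have "tail k x = tail k (tail j x)" using that by (intro eq_by_coordinates) (simp add: cinner_tail)
    then show ?thesis using norm_tail_le[of k "tail j x"] by simp
  qed
  have "norm (tail (max m n) (A x + B x)) \<le> e * norm x" for x
  proof -
    have "norm (tail (max m n) (A x + B x)) \<le> norm (tail (max m n) (A x)) + norm (tail (max m n) (B x))"
      by (simp add: tail_add norm_triangle_ineq)
    also have "\<dots> \<le> e / 2 * norm x + e / 2 * norm x"
      using mono[of m "max m n" "A x"] mono[of n "max m n" "B x"] m[of x] n[of x] by linarith
    finally show ?thesis by simp
  qed
  then show "\<exists>n. \<forall>x. norm (tail n (A x + B x)) \<le> e * norm x" by blast
qed

lemma compact_op_compose_right:
  fixes A B :: "'a \<Rightarrow> 'a"
  assumes A: "compact_op A" and B: "bounded_clinear B"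
  shows "compact_op (A \<circ> B)"
proof (rule compact_opI)
  show "bounded_clinear (A \<circ> B)"
    using assms by (intro bounded_clinear_compose) (auto simp: compact_op_def)
  obtain C where C: "C \<ge> 0" "\<And>x. norm (B x) \<le> C * norm x" using bounded_clinear_bound[OF B] by blast
  fix e :: real assume "0 < e"
  then have "0 < e / (C + 1)" using C by simp
  then obtain n where n: "\<And>x. norm (tail n (A x)) \<le> e / (C + 1) * norm x" using compact_op_tail[OF A] by blast
  have "norm (tail n (A (B x))) \<le> e * norm x" for x
  proof -
    have "norm (B x) \<le> (C + 1) * norm x" using C(2)[of x] by (simp add: distrib_right add_increasing2)
    then have "e / (C + 1) * norm (B x) \<le> e / (C + 1) * ((C + 1) * norm x)"
      using \<open>0 < e / (C + 1)\<close> by (intro mult_left_mono) auto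
    with n[of "B x"] C(1) show ?thesis by simp
  qed
  then show "\<exists>n. \<forall>x. norm (tail n ((A \<circ> B) x)) \<le> e * norm x" by auto
qed

lemma compact_op_compose_left:
  fixes A B :: "'a \<Rightarrow> 'a"
  assumes A: "compact_op A" and B: "bounded_clinear B"
  shows "compact_op (B \<circ> A)"
proof -
  have "continuous_on UNIV B" using B by (simp add: bounded_clinear_def linear_continuous_on)
  then have comp: "compact (B ` closure (A ` cball 0 1))"
    using A by (intro compact_continuous_image) (auto simp: compact_op_def intro: continuous_on_subset)
  have "(B \<circ> A) ` cball 0 1 \<subseteq> B ` closure (A ` cball 0 1)"
    using closure_subset by (force simp: image_comp[symmetric])
  then have "closure ((B \<circ> A) ` cball 0 1) \<subseteq> B ` closure (A ` cball 0 1)"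
    using comp by (intro closure_minimal compact_imp_closed)
  then have "compact (closure ((B \<circ> A) ` cball 0 1))"
    using comp compact_Int_closed[OF comp closed_closure] by (metis inf.absorb2)
  then show ?thesis using A B by (simp add: compact_op_def bounded_clinear_compose)
qed

lemma compact_op_diff:
  fixes A B :: "'a \<Rightarrow> 'a"
  assumes "compact_op A" "compact_op B"
  shows "compact_op (\<lambda>x. A x - B x)"
proof -
  have "compact_op ((\<lambda>x. - 1 *\<^sub>C x) \<circ> B)"
    using assms(2) bounded_clinear_scale[OF bounded_clinear_id, of "- 1"]
    by (intro compact_op_compose_left) simp_all
  then show ?thesis
    using compact_op_add[OF assms(1), of "\<lambda>x. - B x"] by (simp add: o_def scaleC_one)
qed

lemma compact_op_conj_op:
  fixes A V :: "'a \<Rightarrow> 'a"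
  assumes "compact_op A" "bounded_clinear V"
  shows "compact_op (conj_op V A)"
  using assms by (simp add: conj_op_def compact_op_compose_left compact_op_compose_right bounded_clinear_cadjoint)

section \<open>Strictly triangular compact operators\<close>

text \<open>For \<open>l \<noteq> 0\<close>, compactness provides an \<open>n\<close> such that the rows of \<open>A\<close> from \<open>n\<close> on form an operator of norm
less than \<open>\<bar>l\<bar>\<close>, and the rows \<open>n - 1, \<dots>, 0\<close> are then added one by one by means of
\<open>not_in_spectrum_add\<close>. The number \<open>0\<close> does belong to the spectrum because a strictly lower triangular
operator has \<open>f 0\<close> orthogonal to its range and a strictly upper triangular one annihilates \<open>f 0\<close>.\<close>

lemma strictly_triangular_spectrum:
  assumes A: "compact_op A"
    and tri: "(\<forall>i j. i \<le> j \<longrightarrow> entry f A i j = 0) \<or> (\<forall>i j. j \<le> i \<longrightarrow> entry f A i j = 0)"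
  shows "op_spectrum A = {0}"
proof -
  have lin: "bounded_clinear A" using A by (simp add: compact_op_def)
  have "l \<notin> op_spectrum A" if l: "l \<noteq> 0" for l
  proof -
    obtain n where n: "\<And>x. norm (tail n (A x)) \<le> cmod l / 2 * norm x"
      using compact_op_tail[OF A, of "cmod l / 2"] l by auto
    have tA: "bounded_clinear (\<lambda>x. tail k (A x))" for k
      using bounded_clinear_compose[OF bounded_clinear_tail lin] by (simp add: o_def)
    have "l \<notin> op_spectrum (\<lambda>x. tail (n - k) (A x))" for k
    proof (induction k)
      case 0
      show ?case using not_in_spectrum_of_norm_less[OF tA n, of l] l by simp
    next
      case (Suc k)
      show ?case
      proof (cases "k < n")
        case False
        then show ?thesis using Suc by simp
      next
        case True
        define m where "m = n - Suc k"
        have m: "n - k = Suc m" using True by (simp add: m_def)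
        \<comment> \<open>Row \<open>m\<close> of \<open>A\<close>. With the rows \<open>?R\<close> below it, \<open>E ?R = 0\<close> in the lower triangular case,
          since \<open>E\<close> only depends on the coordinates before \<open>m\<close>, and \<open>?R E = 0\<close> in the upper
          triangular case, since then \<open>A (f m)\<close> only has coordinates before \<open>m\<close>.\<close>
        define E where "E x = cinner (A x) (f m) *\<^sub>C f m" for x
        let ?R = "\<lambda>x. tail (Suc m) (A x)"
        have R: "l \<notin> op_spectrum ?R" using Suc m by simp
        have E: "bounded_clinear E"
        proof -
          have "E x = tail m (A x) - tail (Suc m) (A x)" for x
            by (simp add: E_def tail_Suc[of m])
          then have "E = (\<lambda>x. tail m (A x) - tail (Suc m) (A x))" by blast
          then show ?thesis using bounded_clinear_minus[OF tA tA, of m "Suc m"] by simp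
        qed
        have mm: "cinner (A (f m)) (f m) = 0" using tri by (auto simp: entry_def)
        have "l \<notin> op_spectrum E"
          by (rule not_in_spectrum_square_zero[OF E _ l])
            (simp add: E_def bounded_clinear_scaleC[OF lin] mm)
        with R have "l \<notin> op_spectrum (\<lambda>x. E x + ?R x)"
          using tri
        proof (elim disjE)
          assume low: "\<forall>i j. i \<le> j \<longrightarrow> entry f A i j = 0"
          have "E \<circ> tail (Suc m) = (\<lambda>x. 0)"
          proof (rule eq_by_entries)
            show "bounded_clinear (E \<circ> tail (Suc m))" by (intro bounded_clinear_compose E bounded_clinear_tail)
            show "bounded_clinear (\<lambda>x. 0 :: 'a)" by (rule bounded_clinearI[where K = 0]) simp_all
            show "entry f (E \<circ> tail (Suc m)) i j = entry f (\<lambda>x. 0) i j" for i j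
              using low[rule_format, of m j]
              by (auto simp: entry_def tail_basis E_def bounded_clinear_zero[OF lin])
          qed
          then have "E (?R x) = 0" for x by (metis comp_apply)
          then have "l \<notin> op_spectrum (\<lambda>x. ?R x + E x)"
            using not_in_spectrum_add[OF tA E _ l R \<open>l \<notin> op_spectrum E\<close>] by blast
          then show ?thesis by (simp add: add.commute)
        next
          assume up: "\<forall>i j. j \<le> i \<longrightarrow> entry f A i j = 0"
          have "?R (f m) = 0"
            using up by (intro eq_by_coordinates) (auto simp: cinner_tail entry_def)
          then have "?R (E x) = 0" for x
            unfolding E_def by (simp only: bounded_clinear_scaleC[OF lin] tail_scaleC) simp
          then show ?thesis
            using not_in_spectrum_add[OF E tA _ l \<open>l \<notin> op_spectrum E\<close> R] by blast
        qed
        then show ?thesis by (simp add: m_def[symmetric] tail_Suc[of m] E_def)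
      qed
    qed
    from this[of n] show ?thesis by simp
  qed
  moreover have "0 \<in> op_spectrum A"
  proof (rule ccontr)
    assume "0 \<notin> op_spectrum A"
    then obtain B where "bounded_clinear B" "\<And>x. B (A x - 0 *\<^sub>C x) = x" "\<And>x. A (B x) - 0 *\<^sub>C B x = x"
      by (rule not_in_spectrumE) blast
    then have B: "\<And>x. B (A x) = x" "\<And>x. A (B x) = x" "bounded_clinear B" by simp_all
    from tri show False
    proof
      assume low: "\<forall>i j. i \<le> j \<longrightarrow> entry f A i j = 0"
      have "cinner (A (B (f 0))) (f 0) = 0"
        using coordinate_sums[OF lin, of 0 "B (f 0)"] low sums_unique2[OF _ sums_zero] by simp
      then show False by (simp add: B)
    next
      assume up: "\<forall>i j. j \<le> i \<longrightarrow> entry f A i j = 0"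
      then have "A (f 0) = 0" by (intro eq_by_coordinates) (simp add: entry_def[symmetric])
      then have "f 0 = 0" using B(1)[of "f 0"] bounded_clinear_zero[OF B(3)] by simp
      then show False using norm_basis[of 0] by simp
    qed
  qed
  ultimately show ?thesis by blast
qed

end

section \<open>Operators acting block by block\<close>

context hilbert_basis
begin

text \<open>The fibres of \<open>b\<close> and \<open>c\<close> partition the rows and the columns, and the matrix only connects the fibre of
\<open>c\<close> over \<open>p\<close> with the fibre of \<open>b\<close> over the same \<open>p\<close>. Such an operator respects two orthogonal
decompositions of the space, so a common bound \<open>C\<close> for the blocks is a bound for the whole operator.
Using two index functions covers block diagonals and shifted block diagonals alike.\<close>

lemma ex_blockwise_operator:
  fixes b c :: "nat \<Rightarrow> nat"
  assumes fin: "\<And>p. finite {i. b i = p}" "\<And>p. finite {j. c j = p}"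
    and supp: "\<And>i j. b i \<noteq> c j \<Longrightarrow> M i j = 0"
    and bound: "\<And>p a. (\<Sum>i | b i = p. (cmod (\<Sum>j | c j = p. M i j * a j))\<^sup>2)
      \<le> C\<^sup>2 * (\<Sum>j | c j = p. (cmod (a j))\<^sup>2)"
    and C: "0 \<le> C"
  shows "\<exists>A. bounded_clinear A \<and> (\<forall>i j. entry f A i j = M i j) \<and> (\<forall>x. norm (A x) \<le> C * norm x)"
proof -
  define Y where "Y x i = (\<Sum>j | c j = b i. M i j * cinner x (f j))" for x i
  have group: "(\<Sum>i | g i \<in> P. h i) = (\<Sum>p\<in>P. \<Sum>i | g i = p. h i)"
    if "finite P" "\<And>p. finite {i. g i = p}" for P :: "nat set" and g :: "nat \<Rightarrow> nat" and h :: "nat \<Rightarrow> real"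
  proof -
    have "{i. g i \<in> P} = (\<Union>p\<in>P. {i. g i = p})" by blast
    moreover have "(\<Sum>i\<in>(\<Union>p\<in>P. {i. g i = p}). h i) = (\<Sum>p\<in>P. \<Sum>i | g i = p. h i)"
      using that by (intro sum.UNION_disjoint) auto
    ultimately show ?thesis by simp
  qed
  have fin_P: "finite {i. g i \<in> P}" if "finite P" "\<And>p. finite {i. g i = p}" for P :: "nat set" and g :: "nat \<Rightarrow> nat"
  proof -
    have "{i. g i \<in> P} = (\<Union>p\<in>P. {i. g i = p})" by blast
    then show ?thesis using that by simp
  qed
  have "(\<Sum>i<n. (cmod (Y x i))\<^sup>2) \<le> (C * norm x)\<^sup>2" for x n
  proof -
    let ?P = "b ` {..<n}"
    have "(\<Sum>i<n. (cmod (Y x i))\<^sup>2) \<le> (\<Sum>i | b i \<in> ?P. (cmod (Y x i))\<^sup>2)"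
      using fin_P[of ?P b, OF _ fin(1)] by (intro sum_mono2) auto
    also have "\<dots> = (\<Sum>p\<in>?P. \<Sum>i | b i = p. (cmod (Y x i))\<^sup>2)"
      by (intro group fin) simp
    also have "\<dots> = (\<Sum>p\<in>?P. \<Sum>i | b i = p. (cmod (\<Sum>j | c j = p. M i j * cinner x (f j)))\<^sup>2)"
      by (intro sum.cong) (auto simp: Y_def)
    also have "\<dots> \<le> (\<Sum>p\<in>?P. C\<^sup>2 * (\<Sum>j | c j = p. (cmod (cinner x (f j)))\<^sup>2))"
      by (intro sum_mono bound)
    also have "\<dots> = C\<^sup>2 * (\<Sum>j | c j \<in> ?P. (cmod (cinner x (f j)))\<^sup>2)"
      using fin by (subst group) (auto simp: sum_distrib_left)
    also have "\<dots> \<le> C\<^sup>2 * (norm x)\<^sup>2"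
      using fin_P[of ?P c, OF _ fin(2)] by (intro mult_left_mono bessel) auto
    finally show ?thesis by (simp add: power_mult_distrib)
  qed
  then obtain A where A: "bounded_clinear A" "\<And>x i. cinner (A x) (f i) = Y x i" "\<And>x. norm (A x) \<le> C * norm x"
    using ex_operator_of_coordinates[of Y C] C
    by (auto simp: Y_def cinner_add_left distrib_left sum.distrib sum_distrib_left mult_ac)
  have "entry f A i j = M i j" for i j
  proof -
    have "entry f A i j = (\<Sum>k | c k = b i. if k = j then M i j else 0)"
      unfolding entry_def A(2) Y_def by (intro sum.cong) auto
    also have "\<dots> = M i j" using fin(2) supp[of i j] by (auto simp: sum.delta)
    finally show ?thesis .
  qed
  with A show ?thesis by blast
qed

text \<open>Each block is cut out of \<open>K\<close> by orthogonal projections on both sides, so its norm is at most that of \<open>K\<close>.\<close>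

lemma ex_masked_operator:
  fixes b c :: "nat \<Rightarrow> nat"
  assumes K: "bounded_clinear K" "\<And>x. norm (K x) \<le> C * norm x" "0 \<le> C"
    and fin: "\<And>p. finite {i. b i = p}" "\<And>p. finite {j. c j = p}"
  shows "\<exists>A. bounded_clinear A \<and> (\<forall>i j. entry f A i j = (if b i = c j then entry f K i j else 0)) \<and>
    (\<forall>x. norm (A x) \<le> C * norm x)"
proof (rule ex_blockwise_operator[where b = b and c = c])
  fix p and a :: "nat \<Rightarrow> complex"
  define z where "z = (\<Sum>j | c j = p. a j *\<^sub>C f j)"
  have "(\<Sum>i | b i = p. (cmod (\<Sum>j | c j = p. (if b i = c j then entry f K i j else 0) * a j))\<^sup>2)
    = (\<Sum>i | b i = p. (cmod (cinner (K z) (f i)))\<^sup>2)"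
  proof (intro sum.cong refl)
    fix i assume "i \<in> {i. b i = p}"
    then have "(\<Sum>j | c j = p. (if b i = c j then entry f K i j else 0) * a j) = (\<Sum>j | c j = p. entry f K i j * a j)"
      by (intro sum.cong) auto
    also have "\<dots> = cinner (K z) (f i)"
      by (simp add: z_def bounded_clinear_sum[OF K(1)] bounded_clinear_scaleC[OF K(1)] cinner_sum_left entry_def mult.commute)
    finally show "(cmod (\<Sum>j | c j = p. (if b i = c j then entry f K i j else 0) * a j))\<^sup>2 = (cmod (cinner (K z) (f i)))\<^sup>2"
      by simp
  qed
  also have "\<dots> \<le> (norm (K z))\<^sup>2" by (intro bessel fin)
  also have "\<dots> \<le> (C * norm z)\<^sup>2" by (intro power_mono K) simp
  also have "\<dots> = C\<^sup>2 * (\<Sum>j | c j = p. (cmod (a j))\<^sup>2)"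
    using fin(2) by (simp add: z_def power_mult_distrib norm_sum_basis_sq)
  finally show "(\<Sum>i | b i = p. (cmod (\<Sum>j | c j = p. (if b i = c j then entry f K i j else 0) * a j))\<^sup>2)
    \<le> C\<^sup>2 * (\<Sum>j | c j = p. (cmod (a j))\<^sup>2)" .
qed (use fin K in auto)

text \<open>Removing the first \<open>n\<close> rows commutes with masking, so the norm bounds on the tails of \<open>K\<close> carry over to
the masked operator.\<close>

lemma ex_compact_masked_operator:
  fixes b c :: "nat \<Rightarrow> nat"
  assumes K: "compact_op K"
    and fin: "\<And>p. finite {i. b i = p}" "\<And>p. finite {j. c j = p}"
  shows "\<exists>A. compact_op A \<and> (\<forall>i j. entry f A i j = (if b i = c j then entry f K i j else 0))"
proof -
  have lin: "bounded_clinear K" using K by (simp add: compact_op_def)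
  obtain C where C: "0 \<le> C" "\<And>x. norm (K x) \<le> C * norm x" using bounded_clinear_bound[OF lin] by blast
  obtain A where A: "bounded_clinear A" "\<And>i j. entry f A i j = (if b i = c j then entry f K i j else 0)"
    using ex_masked_operator[OF lin C(2,1) fin] by blast
  have "compact_op A"
  proof (rule compact_opI[OF A(1)])
    fix e :: real assume "0 < e"
    then obtain n where n: "\<And>x. norm (tail n (K x)) \<le> e * norm x" using compact_op_tail[OF K] by blast
    have tK: "bounded_clinear (tail n \<circ> K)" by (intro bounded_clinear_compose bounded_clinear_tail lin)
    obtain A' where A': "bounded_clinear A'" "\<And>x. norm (A' x) \<le> e * norm x"
      "\<And>i j. entry f A' i j = (if b i = c j then entry f (tail n \<circ> K) i j else 0)"
      using ex_masked_operator[OF tK, of e b c] n \<open>0 < e\<close> fin by auto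
    have "A' = tail n \<circ> A"
      using A(2) by (intro eq_by_entries A' bounded_clinear_compose bounded_clinear_tail A(1))
        (simp add: A'(3), simp add: entry_def cinner_tail)
    then show "\<exists>n. \<forall>x. norm (tail n (A x)) \<le> e * norm x" using A'(2) by auto
  qed
  with A(2) show ?thesis by blast
qed

lemma image_basis_eq_sum:
  assumes "finite F" "\<And>k. k \<notin> F \<Longrightarrow> entry f V k j = 0"
  shows "V (f j) = (\<Sum>k\<in>F. entry f V k j *\<^sub>C f k)"
  using assms by (intro eq_by_coordinates) (auto simp: cinner_sum_basis entry_def)

lemma entry_compose:
  assumes "bounded_clinear A" "finite F" "\<And>k. k \<notin> F \<Longrightarrow> entry f V k j = 0"
  shows "entry f (A \<circ> V) i j = (\<Sum>k\<in>F. entry f A i k * entry f V k j)"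
  using image_basis_eq_sum[of F V j] assms
  by (simp add: entry_def[of f "A \<circ> V"] bounded_clinear_sum bounded_clinear_scaleC cinner_sum_left)
    (simp add: entry_def[of f A] mult.commute)

lemma entry_conj_op_sum:
  assumes "bounded_clinear A" "bounded_clinear V" "finite F" "finite G"
    "\<And>k. k \<notin> F \<Longrightarrow> entry f V k i = 0" "\<And>k. k \<notin> G \<Longrightarrow> entry f V k j = 0"
  shows "entry f (conj_op V A) i j =
    (\<Sum>k\<in>F. \<Sum>l\<in>G. cnj (entry f V k i) * entry f A k l * entry f V l j)"
proof -
  have "entry f (conj_op V A) i j = (\<Sum>k\<in>F. cnj (entry f V k i) * cinner (A (V (f j))) (f k))"
    unfolding entry_conj_op[OF assms(2)] using image_basis_eq_sum[of F V i] assms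
    by (simp add: cinner_sum_right)
  also have "\<dots> = (\<Sum>k\<in>F. cnj (entry f V k i) * (\<Sum>l\<in>G. entry f A k l * entry f V l j))"
    using entry_compose[of A G V j] assms by (simp add: entry_def[of f "A \<circ> V"])
  finally show ?thesis by (simp add: sum_distrib_left mult.assoc)
qed

end

section \<open>The block partition\<close>

lemma bstart_Suc_eq: "bstart (Suc n) = 3 ^ n"
proof (induction n)
  case (Suc n)
  have "bstart (Suc (Suc n)) = bstart (Suc n) + bsize (Suc n)" by (simp add: bstart_def)
  with Suc show ?case by (simp add: bsize_def)
qed (simp add: bstart_def bsize_def)

lemma bstart_Suc: "bstart (Suc n) = bstart n + bsize n"
  by (simp add: bstart_def)

lemma bstart_mono: "m \<le> n \<Longrightarrow> bstart m \<le> bstart n"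
  by (simp add: bstart_def sum_mono2)

lemma bindex_eq_iff: "bindex i = n \<longleftrightarrow> bstart n \<le> i \<and> i < bstart (Suc n)"
proof -
  have "i < bstart (Suc i)" by (simp add: bstart_Suc_eq power_gt_expt)
  then have lt: "i < bstart (Suc (bindex i))" unfolding bindex_def by (rule LeastI)
  have ge: "bstart (bindex i) \<le> i"
  proof (cases "bindex i")
    case (Suc m)
    then have "\<not> i < bstart (Suc m)"
      unfolding bindex_def using not_less_Least[of m "\<lambda>n. i < bstart (Suc n)"] by simp
    then show ?thesis using Suc by simp
  qed (simp add: bstart_def)
  show ?thesis
  proof
    assume *: "bstart n \<le> i \<and> i < bstart (Suc n)"
    have "\<not> Suc n \<le> bindex i" using bstart_mono[of "Suc n" "bindex i"] ge * by linarith
    moreover have "\<not> Suc (bindex i) \<le> n" using bstart_mono[of "Suc (bindex i)" n] lt * by linarith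
    ultimately show "bindex i = n" by linarith
  qed (use lt ge in auto)
qed

lemma bstart_bindex_le: "bstart (bindex i) \<le> i"
  and offset_less: "i - bstart (bindex i) < bsize (bindex i)"
  using bindex_eq_iff[of i "bindex i"] by (auto simp: bstart_Suc)

lemma bindex_mono: "i \<le> j \<Longrightarrow> bindex i \<le> bindex j"
proof (rule ccontr)
  assume "i \<le> j" "\<not> bindex i \<le> bindex j"
  then have "bstart (Suc (bindex j)) \<le> bstart (bindex i)" by (intro bstart_mono) simp
  then show False
    using bindex_eq_iff[of i "bindex i"] bindex_eq_iff[of j "bindex j"] \<open>i \<le> j\<close> by simp
qed

lemma bindex_fibre: "{i. bindex i = p} = {bstart p..<bstart p + bsize p}"
  by (auto simp: bindex_eq_iff bstart_Suc)

lemma finite_bindex_fibre: "finite {i. bindex i = p}" "finite {i. Suc (bindex i) = p}"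
  by (cases p; simp add: bindex_fibre)+

lemma sum_bindex_fibre: "(\<Sum>i | bindex i = p. g i) = (\<Sum>r<bsize p. g (bstart p + r))"
  unfolding bindex_fibre
  by (simp add: sum.shift_bounds_nat_ivl[of g 0 "bstart p" "bsize p", simplified] lessThan_atLeast0 add.commute)

lemma bindex_bstart_add: "r < bsize p \<Longrightarrow> bindex (bstart p + r) = p"
  by (simp add: bindex_eq_iff bstart_Suc)

lemma block_entry:
  "block f K (bindex i) (bindex j) $$ (i - bstart (bindex i), j - bstart (bindex j)) = entry f K i j"
  by (simp add: block_def offset_less bstart_bindex_le)

section \<open>Unitary matrices and their direct sums\<close>

lemma mat_adjoint_carrier: "X \<in> carrier_mat n n \<Longrightarrow> mat_adjoint X \<in> carrier_mat n n"
  by (auto simp: mat_adjoint_def)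

lemma mat_adjoint_index:
  "X \<in> carrier_mat n n \<Longrightarrow> i < n \<Longrightarrow> j < n \<Longrightarrow> mat_adjoint X $$ (i, j) = cnj (X $$ (j, i))"
  by (auto simp: mat_adjoint_def mat_of_rows_index)

lemma mat_adjoint_twice: "X \<in> carrier_mat n n \<Longrightarrow> mat_adjoint (mat_adjoint X) = (X :: complex mat)"
proof -
  assume X: "X \<in> carrier_mat n n"
  note car = mat_adjoint_carrier[OF X] mat_adjoint_carrier[OF mat_adjoint_carrier[OF X]]
  show ?thesis
    using X car by (intro eq_matI) (simp_all add: mat_adjoint_index[OF X] mat_adjoint_index[OF car(1)])
qed

lemma unitary_mat_adjoint: "unitary_mat n X \<Longrightarrow> unitary_mat n (mat_adjoint X)"
  by (auto simp: unitary_mat_def mat_adjoint_twice mat_adjoint_carrier)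

lemma mat_mult_index:
  "X \<in> carrier_mat n n \<Longrightarrow> Y \<in> carrier_mat n n \<Longrightarrow> i < n \<Longrightarrow> j < n \<Longrightarrow>
    (X * Y) $$ (i, j) = (\<Sum>k<n. X $$ (i, k) * Y $$ (k, j))"
  by (auto simp: scalar_prod_def lessThan_atLeast0)

lemma unitary_mat_isometry:
  assumes "unitary_mat n X"
  shows "(\<Sum>r<n. (cmod (\<Sum>s<n. X $$ (r, s) * a s))\<^sup>2) = (\<Sum>s<n. (cmod (a s))\<^sup>2)"
proof -
  have X: "X \<in> carrier_mat n n" and XX: "mat_adjoint X * X = 1\<^sub>m n" using assms by (auto simp: unitary_mat_def)
  have orth: "(\<Sum>r<n. cnj (X $$ (r, t)) * X $$ (r, s)) = (if t = s then 1 else 0)" if "s < n" "t < n" for s t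
  proof -
    have "(\<Sum>r<n. cnj (X $$ (r, t)) * X $$ (r, s)) = (mat_adjoint X * X) $$ (t, s)"
      using that X by (simp add: mat_mult_index[of _ n] mat_adjoint_carrier mat_adjoint_index[of _ n] del: index_mult_mat)
    then show ?thesis using that by (simp add: XX)
  qed
  have "complex_of_real (\<Sum>r<n. (cmod (\<Sum>s<n. X $$ (r, s) * a s))\<^sup>2)
    = (\<Sum>r<n. \<Sum>s<n. \<Sum>t<n. (X $$ (r, s) * a s) * cnj (X $$ (r, t) * a t))"
    by (simp only: of_real_sum complex_norm_square cnj_sum sum_product)
  also have "\<dots> = (\<Sum>s<n. \<Sum>r<n. \<Sum>t<n. (X $$ (r, s) * a s) * cnj (X $$ (r, t) * a t))"
    by (rule sum.swap)
  also have "\<dots> = (\<Sum>s<n. \<Sum>t<n. \<Sum>r<n. (X $$ (r, s) * a s) * cnj (X $$ (r, t) * a t))"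
    by (intro sum.cong refl sum.swap)
  also have "\<dots> = (\<Sum>s<n. \<Sum>t<n. a s * cnj (a t) * (\<Sum>r<n. cnj (X $$ (r, t)) * X $$ (r, s)))"
    by (simp add: sum_distrib_left mult_ac)
  also have "\<dots> = (\<Sum>s<n. \<Sum>t<n. if t = s then a s * cnj (a s) else 0)"
    by (intro sum.cong refl) (simp add: orth)
  also have "\<dots> = (\<Sum>s<n. a s * cnj (a s))" by (simp add: sum.delta)
  also have "\<dots> = complex_of_real (\<Sum>s<n. (cmod (a s))\<^sup>2)"
    by (simp only: of_real_sum complex_norm_square)
  finally show ?thesis by (simp only: of_real_eq_iff)
qed

context hilbert_basis
begin

lemma direct_sum_op:
  assumes Us: "\<And>n. unitary_mat (bsize n) (Us n)"
  shows bounded_clinear_direct_sum_op: "bounded_clinear (direct_sum_op f Us)"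
    and entry_direct_sum_op: "entry f (direct_sum_op f Us) i j = (if bindex i = bindex j
      then Us (bindex i) $$ (i - bstart (bindex i), j - bstart (bindex j)) else 0)"
proof -
  define M where "M i j = (if bindex i = bindex j
      then Us (bindex i) $$ (i - bstart (bindex i), j - bstart (bindex j)) else 0)" for i j
  have "\<exists>A. bounded_clinear A \<and> (\<forall>i j. entry f A i j = M i j) \<and> (\<forall>x. norm (A x) \<le> 1 * norm x)"
  proof (rule ex_blockwise_operator[where b = bindex and c = bindex])
    fix p and a :: "nat \<Rightarrow> complex"
    have "(\<Sum>i | bindex i = p. (cmod (\<Sum>j | bindex j = p. M i j * a j))\<^sup>2)
      = (\<Sum>r<bsize p. (cmod (\<Sum>s<bsize p. Us p $$ (r, s) * a (bstart p + s)))\<^sup>2)"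
      by (simp add: sum_bindex_fibre M_def bindex_bstart_add)
    also have "\<dots> = (\<Sum>s<bsize p. (cmod (a (bstart p + s)))\<^sup>2)"
      by (rule unitary_mat_isometry[OF Us])
    finally show "(\<Sum>i | bindex i = p. (cmod (\<Sum>j | bindex j = p. M i j * a j))\<^sup>2)
      \<le> 1\<^sup>2 * (\<Sum>j | bindex j = p. (cmod (a j))\<^sup>2)"
      by (simp add: sum_bindex_fibre)
  qed (auto simp: M_def finite_bindex_fibre)
  then obtain A where A: "bounded_clinear A" "\<And>i j. entry f A i j = M i j" by blast
  have "direct_sum_op f Us = A"
    unfolding direct_sum_op_def op_of_blocks_def
    by (rule op_of_matrix_eq[OF A(1)]) (simp add: A(2) M_def offset_less)
  with A show "bounded_clinear (direct_sum_op f Us)"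
    "entry f (direct_sum_op f Us) i j = (if bindex i = bindex j
      then Us (bindex i) $$ (i - bstart (bindex i), j - bstart (bindex j)) else 0)"
    by (simp_all add: M_def)
qed

lemma direct_sum_op_mult:
  assumes "\<And>n. unitary_mat (bsize n) (X n)" "\<And>n. unitary_mat (bsize n) (Y n)"
    and XY: "\<And>n. X n * Y n = 1\<^sub>m (bsize n)"
  shows "direct_sum_op f X \<circ> direct_sum_op f Y = id"
proof (rule eq_by_entries)
  note lin = bounded_clinear_direct_sum_op[OF assms(1)] bounded_clinear_direct_sum_op[OF assms(2)]
  show "bounded_clinear (direct_sum_op f X \<circ> direct_sum_op f Y)" by (intro bounded_clinear_compose lin)
  show "bounded_clinear (id :: 'a \<Rightarrow> 'a)" by (rule bounded_clinear_id)
  fix i j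
  have car: "X n \<in> carrier_mat (bsize n) (bsize n)" "Y n \<in> carrier_mat (bsize n) (bsize n)" for n
    using assms by (auto simp: unitary_mat_def)
  have "entry f (direct_sum_op f X \<circ> direct_sum_op f Y) i j
    = (\<Sum>k | bindex k = bindex j. entry f (direct_sum_op f X) i k * entry f (direct_sum_op f Y) k j)"
    by (intro entry_compose lin finite_bindex_fibre) (auto simp: entry_direct_sum_op assms(2))
  also have "\<dots> = (if i = j then 1 else 0)"
  proof (cases "bindex i = bindex j")
    case True
    define p where "p = bindex j"
    have "(\<Sum>k | bindex k = bindex j. entry f (direct_sum_op f X) i k * entry f (direct_sum_op f Y) k j)
      = (\<Sum>r<bsize p. X p $$ (i - bstart p, r) * Y p $$ (r, j - bstart p))"
      using True by (simp add: sum_bindex_fibre entry_direct_sum_op assms(1,2) bindex_bstart_add p_def)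
    also have "\<dots> = (X p * Y p) $$ (i - bstart p, j - bstart p)"
      using car[of p] offset_less[of i] offset_less[of j] True by (simp add: mat_mult_index[of _ "bsize (bindex j)"] p_def del: index_mult_mat)
    also have "\<dots> = (if i = j then 1 else 0)"
      using offset_less[of i] offset_less[of j] bstart_bindex_le[of i] bstart_bindex_le[of j] True
      by (auto simp: XY p_def)
    finally show ?thesis .
  next
    case False
    then show ?thesis by (auto simp: entry_direct_sum_op assms(1,2) intro!: sum.neutral)
  qed
  also have "\<dots> = entry f id i j" by (simp add: entry_def)
  finally show "entry f (direct_sum_op f X \<circ> direct_sum_op f Y) i j = entry f id i j" .
qed

lemma unitary_direct_sum_op:
  assumes Us: "\<And>n. unitary_mat (bsize n) (Us n)"
  shows "unitary_op (direct_sum_op f Us)"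
proof -
  let ?V = "\<lambda>n. mat_adjoint (Us n)"
  have V: "unitary_mat (bsize n) (?V n)" for n using Us by (rule unitary_mat_adjoint)
  have car: "Us n \<in> carrier_mat (bsize n) (bsize n)" for n using Us[of n] by (simp add: unitary_mat_def)
  have "cadjoint (direct_sum_op f Us) = direct_sum_op f ?V"
  proof (rule cadjoint_eq_by_entries)
    fix i j
    show "entry f (direct_sum_op f ?V) i j = cnj (entry f (direct_sum_op f Us) j i)"
      using offset_less[of i] offset_less[of j] car[of "bindex j"]
      by (auto simp: entry_direct_sum_op Us V mat_adjoint_index)
  qed (intro bounded_clinear_direct_sum_op Us V)+
  moreover have "direct_sum_op f ?V \<circ> direct_sum_op f Us = id" "direct_sum_op f Us \<circ> direct_sum_op f ?V = id"
    using Us V by (auto intro!: direct_sum_op_mult simp: unitary_mat_def)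
  ultimately show ?thesis
    unfolding unitary_op_def using bounded_clinear_direct_sum_op[OF Us] by simp
qed

end

section \<open>Unitary triangularization of matrices\<close>

text \<open>\<open>u k\<close> is the normalized component of \<open>p k\<close> orthogonal to the earlier \<open>p j\<close>. It is orthogonal to
\<open>u j\<close> for \<open>j < k\<close> because \<open>u j\<close> lies in their span, so different indices can be treated independently.\<close>

lemma ex_gram_schmidt:
  fixes p :: "nat \<Rightarrow> 'a::complex_hilbert"
  assumes "\<And>k. k < n \<Longrightarrow> p k \<notin> cspan (p ` {..<k})"
  shows "\<exists>u. \<forall>k<n. norm (u k) = 1 \<and> u k \<in> cspan (p ` {..k}) \<and> (\<forall>j<k. cinner (u k) (p j) = 0)"
proof -
  have "\<forall>k. \<exists>u. k < n \<longrightarrow> norm u = 1 \<and> u \<in> cspan (p ` {..k}) \<and> (\<forall>j<k. cinner u (p j) = 0)"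
  proof
    fix k
    have "insert (p k) (p ` {..<k}) = p ` {..k}" by (auto simp: le_less)
    then show "\<exists>u. k < n \<longrightarrow> norm u = 1 \<and> u \<in> cspan (p ` {..k}) \<and> (\<forall>j<k. cinner u (p j) = 0)"
      using ex_unit_orthogonal[of "p ` {..<k}" "p k"] assms[of k] by (cases "k < n") auto
  qed
  then show ?thesis by metis
qed

context hilbert_basis
begin

lemma cinner_sums_basis:
  "cinner (\<Sum>i<n. a i *\<^sub>C f i) (\<Sum>i<n. b i *\<^sub>C f i) = (\<Sum>i<n. a i * cnj (b i))"
proof -
  have "cinner (\<Sum>i<n. a i *\<^sub>C f i) (\<Sum>i<n. b i *\<^sub>C f i) = (\<Sum>i<n. cnj (b i) * cinner (\<Sum>i<n. a i *\<^sub>C f i) (f i))"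
    by (simp only: cinner_sum_right cinner_scaleC_right)
  also have "\<dots> = (\<Sum>i<n. a i * cnj (b i))" by (simp add: cinner_sum_basis mult.commute)
  finally show ?thesis .
qed

text \<open>\<open>A\<close> is similar to an upper triangular \<open>B\<close>, say \<open>A P = P B\<close>, so each of the spaces spanned by the first
columns of \<open>P\<close> is invariant under \<open>A\<close>. Orthonormalizing the columns keeps these spaces, and with respect
to the new orthonormal columns \<open>A\<close> is therefore upper triangular as well. Vectors of length \<open>n\<close> are
represented in the span of \<open>f 0, \<dots>, f (n - 1)\<close>, where the Gram-Schmidt process above applies.\<close>

lemma ex_unitary_schur:
  assumes A: "A \<in> carrier_mat n n"
  shows "\<exists>U. unitary_mat n U \<and> upper_triangular (mat_adjoint U * A * U)"
proof -
  obtain es where "char_poly A = (\<Prod>e\<leftarrow>es. [:- e, 1:])" using char_poly_factorized[OF A] by blast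
  then obtain B where B: "B \<in> carrier_mat n n" "upper_triangular B" "similar_mat A B"
    using schur_decomposition_exists[OF A] by blast
  then obtain P Q where PQ: "similar_mat_wit A B P Q" by (auto simp: similar_mat_def)
  have P: "P \<in> carrier_mat n n" and Q: "Q \<in> carrier_mat n n" and QP: "Q * P = 1\<^sub>m n" and APBQ: "A = P * B * Q"
    using similar_mat_witD2[OF A PQ] by simp_all
  have AP: "A * P = P * B"
    unfolding APBQ using P Q B(1) by (simp add: assoc_mult_mat[of _ n n _ n _ n] QP)
  define p where "p k = (\<Sum>i<n. P $$ (i, k) *\<^sub>C f i)" for k
  have indep: "p k \<notin> cspan (p ` {..<k})" if "k < n" for k
  proof
    assume k: "p k \<in> cspan (p ` {..<k})"
    \<comment> \<open>Row \<open>k\<close> of \<open>P\<^sup>-\<^sup>1\<close> is dual to the columns of \<open>P\<close>: it vanishes on all columns but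
      the one with index \<open>k\<close>.\<close>
    define q where "q = (\<Sum>i<n. cnj (Q $$ (k, i)) *\<^sub>C f i)"
    have "cinner q (p j) = (if j = k then 1 else 0)" if "j < n" for j
    proof -
      have "cinner (p j) q = (\<Sum>i<n. Q $$ (k, i) * P $$ (i, j))"
        by (simp add: p_def q_def cinner_sums_basis mult.commute)
      also have "\<dots> = (Q * P) $$ (k, j)"
        using P Q that \<open>k < n\<close> by (simp add: mat_mult_index[of _ n] del: index_mult_mat)
      also have "\<dots> = (if j = k then 1 else 0)" using QP that \<open>k < n\<close> by simp
      finally show ?thesis using cinner_commute[of q "p j"] by simp
    qed
    then have "cinner q (p k) = 1" "\<And>s. s \<in> p ` {..<k} \<Longrightarrow> cinner q s = 0" using \<open>k < n\<close> by auto
    then show False using cinner_eq_zero_cspan[of "p ` {..<k}" q "p k"] k by simp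
  qed
  obtain u where u: "\<And>k. k < n \<Longrightarrow> norm (u k) = 1" "\<And>k. k < n \<Longrightarrow> u k \<in> cspan (p ` {..k})"
    "\<And>j k. k < n \<Longrightarrow> j < k \<Longrightarrow> cinner (u k) (p j) = 0"
    using ex_gram_schmidt[of n p] indep by blast
  define U where "U = mat n n (\<lambda>(i, j). cinner (u j) (f i))"
  have U: "U \<in> carrier_mat n n" by (simp add: U_def)
  have u_sum: "u j = (\<Sum>i<n. U $$ (i, j) *\<^sub>C f i)" if "j < n" for j
  proof -
    have "complex_vector.subspace {x. tail n x = 0}"
      by (auto simp: complex_vector.subspace_def tail_add tail_scaleC bounded_clinear_zero[OF bounded_clinear_tail])
    moreover have "p ` {..j} \<subseteq> {x. tail n x = 0}"
      by (auto simp: p_def bounded_clinear_sum[OF bounded_clinear_tail] tail_scaleC tail_basis)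
    ultimately have "tail n (u j) = 0" using complex_vector.span_minimal u(2)[OF that] by blast
    then have "u j = (\<Sum>i<n. cinner (u j) (f i) *\<^sub>C f i)" by (simp add: tail_def)
    also have "\<dots> = (\<Sum>i<n. U $$ (i, j) *\<^sub>C f i)" using that by (intro sum.cong) (auto simp: U_def)
    finally show ?thesis .
  qed
  have orth_less: "cinner (u j) (u i) = 0" if "i < j" "j < n" for i j
  proof (rule cinner_eq_zero_cspan)
    show "u i \<in> cspan (p ` {..i})" using that by (intro u(2)) simp
    show "cinner (u j) s = 0" if "s \<in> p ` {..i}" for s
    proof -
      obtain m where "m \<le> i" "s = p m" using \<open>s \<in> p ` {..i}\<close> by blast
      then show ?thesis using u(3)[of j m] \<open>i < j\<close> \<open>j < n\<close> by simp
    qed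
  qed
  have orth: "cinner (u j) (u i) = (if i = j then 1 else 0)" if "i < n" "j < n" for i j
  proof (cases i j rule: linorder_cases)
    case equal
    then show ?thesis using norm_sq_eq_cinner[of "u j"] u(1)[OF that(2)] by simp
  next
    case greater
    then show ?thesis using orth_less[of j i] that cinner_commute[of "u j" "u i"] by simp
  qed (use orth_less that in auto)
  have UU: "mat_adjoint U * U = 1\<^sub>m n"
  proof (rule eq_matI)
    fix i j assume "i < dim_row (1\<^sub>m n :: complex mat)" "j < dim_col (1\<^sub>m n :: complex mat)"
    then have ij: "i < n" "j < n" by simp_all
    then have "(mat_adjoint U * U) $$ (i, j) = (\<Sum>k<n. U $$ (k, j) * cnj (U $$ (k, i)))"
      using U by (simp add: mat_mult_index[of _ n] mat_adjoint_carrier mat_adjoint_index[of _ n] mult.commute del: index_mult_mat)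
    also have "\<dots> = cinner (u j) (u i)" using ij by (simp add: u_sum cinner_sums_basis)
    finally show "(mat_adjoint U * U) $$ (i, j) = 1\<^sub>m n $$ (i, j)" using orth ij by simp
  qed (use U mat_adjoint_carrier[OF U] in auto)
  moreover have "U * mat_adjoint U = 1\<^sub>m n"
    using UU mat_mult_left_right_inverse[OF mat_adjoint_carrier[OF U] U] by simp
  ultimately have "unitary_mat n U" using U by (simp add: unitary_mat_def)
  moreover have "upper_triangular (mat_adjoint U * A * U)"
  proof (rule upper_triangularI)
    fix i j assume "j < i" "i < dim_row (mat_adjoint U * A * U)"
    then have ij: "j < i" "i < n" "j < n" using mat_adjoint_carrier[OF U] by auto
    \<comment> \<open>\<open>w\<close> is \<open>A\<^sup>* (u i)\<close>, so the entry in question is \<open>\<langle>u j, w\<rangle>\<close>; it is shown that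
      \<open>w\<close> is orthogonal to the columns of \<open>P\<close> up to index \<open>j\<close>, whose span contains \<open>u j\<close>.\<close>
    define w where "w = (\<Sum>l<n. cnj (\<Sum>k<n. cnj (U $$ (k, i)) * A $$ (k, l)) *\<^sub>C f l)"
    have "cinner (p m) w = 0" if "m \<le> j" for m
    proof -
      have m: "m < n" using that ij by simp
      have "cinner (p m) w = (\<Sum>l<n. \<Sum>k<n. P $$ (l, m) * (cnj (U $$ (k, i)) * A $$ (k, l)))"
        by (simp add: p_def w_def cinner_sums_basis sum_distrib_left)
      also have "\<dots> = (\<Sum>k<n. \<Sum>l<n. P $$ (l, m) * (cnj (U $$ (k, i)) * A $$ (k, l)))" by (rule sum.swap)
      also have "\<dots> = (\<Sum>k<n. cnj (U $$ (k, i)) * (A * P) $$ (k, m))"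
        using A P m by (simp add: mat_mult_index[of _ n] sum_distrib_left mult_ac del: index_mult_mat)
      also have "\<dots> = (\<Sum>k<n. \<Sum>r<n. cnj (U $$ (k, i)) * (P $$ (k, r) * B $$ (r, m)))"
        unfolding AP using B(1) P m by (simp add: mat_mult_index[of _ n] sum_distrib_left del: index_mult_mat)
      also have "\<dots> = (\<Sum>r<n. \<Sum>k<n. cnj (U $$ (k, i)) * (P $$ (k, r) * B $$ (r, m)))" by (rule sum.swap)
      also have "\<dots> = (\<Sum>r<n. B $$ (r, m) * cinner (p r) (u i))"
        using ij by (simp add: p_def u_sum cinner_sums_basis sum_distrib_left mult_ac)
      also have "\<dots> = 0"
      proof (rule sum.neutral, rule ballI)
        fix r assume "r \<in> {..<n}"
        show "B $$ (r, m) * cinner (p r) (u i) = 0"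
        proof (cases "m < r")
          case True
          then show ?thesis using B(1,2) \<open>r \<in> {..<n}\<close> by (auto dest: upper_triangularD)
        next
          case False
          then have "cinner (u i) (p r) = 0" using u(3)[of i r] ij that by simp
          then show ?thesis using cinner_commute[of "p r" "u i"] by simp
        qed
      qed
      finally show ?thesis .
    qed
    then have "cinner w s = 0" if "s \<in> p ` {..j}" for s
      using that cinner_commute[of w s] by auto
    then have "cinner w (u j) = 0" using u(2)[OF ij(3)] by (rule cinner_eq_zero_cspan)
    then have "cinner (u j) w = 0" using cinner_commute[of "u j" w] by simp
    moreover have "cinner (u j) w = (\<Sum>l<n. U $$ (l, j) * (\<Sum>k<n. cnj (U $$ (k, i)) * A $$ (k, l)))"
      using ij by (simp add: u_sum w_def cinner_sums_basis)
    moreover have "\<dots> = (mat_adjoint U * A * U) $$ (i, j)"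
      using A U ij by (simp add: mat_mult_index[of _ n] mat_adjoint_carrier mat_adjoint_index[of _ n]
          mult.commute mult_carrier_mat[of _ n n] del: index_mult_mat)
    ultimately show "(mat_adjoint U * A * U) $$ (i, j) = 0" by simp
  qed
  ultimately show ?thesis by blast
qed

end

section \<open>Bases adapted to two operators\<close>

text \<open>The vectors are chosen one after the other, and each step forces one prescribed vector into the span
of those chosen so far. The steps \<open>3 k\<close>, \<open>3 k + 1\<close> and \<open>3 k + 2\<close> take care of the \<open>k\<close>-th member of a
dense sequence, of \<open>A (f k)\<close> and of \<open>B (f k)\<close>; the last two are known in time because \<open>k < 3 k + 1\<close>. If
the prescribed vector already lies in the span, any unit vector orthogonal to that span will do, and one exists
because the dimension is infinite.\<close>

lemma ex_basis_controlling_images: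
  fixes A B :: "'a::complex_hilbert \<Rightarrow> 'a"
  assumes sep: "separable_space (euclidean :: 'a topology)" and inf: "infinite_dimensional TYPE('a)"
  shows "\<exists>f. orthonormal_basis f \<and>
    (\<forall>k. A (f k) \<in> cspan (f ` {..3 * k + 1}) \<and> B (f k) \<in> cspan (f ` {..3 * k + 2}))"
proof -
  obtain D :: "'a set" where D: "countable D" "closure D = UNIV"
    using sep by (auto simp: separable_space_def)
  then have "D \<noteq> {}" by auto
  with D obtain g :: "nat \<Rightarrow> 'a" where g: "range g = D"
    by (metis range_from_nat_into)
  have ext: "\<exists>u. norm u = 1 \<and> (\<forall>s\<in>S. cinner u s = 0) \<and> v \<in> cspan (insert u S)" if S: "finite S" for S and v :: 'a
  proof (cases "v \<in> cspan S")
    case False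
    then show ?thesis using ex_unit_orthogonal[OF S] by blast
  next
    case True
    obtain x where "x \<notin> cspan S" using inf S by (auto simp: infinite_dimensional_def)
    then obtain u where "norm u = 1" "\<forall>s\<in>S. cinner u s = 0" using ex_unit_orthogonal[OF S] by blast
    moreover have "v \<in> cspan (insert u S)" using True complex_vector.span_mono[of S "insert u S"] by blast
    ultimately show ?thesis by blast
  qed
  \<comment> \<open>The vector that must lie in the span after step \<open>m\<close>.\<close>
  define v where "v f m = (if m mod 3 = 0 then g (m div 3) else if m mod 3 = 1 then A (f (m div 3)) else B (f (m div 3)))"
    for f and m :: nat
  define step where "step f m u \<longleftrightarrow> norm u = 1 \<and> (\<forall>s\<in>f ` {..<m}. cinner u s = 0) \<and> v f m \<in> cspan (insert u (f ` {..<m}))"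
    for f and m :: nat and u
  have "\<exists>f. \<forall>m. step f m (f m)"
  proof (rule dependent_wellorder_choice)
    fix r and f h :: "nat \<Rightarrow> 'a" and m :: nat
    assume eq: "\<And>y. y < m \<Longrightarrow> f y = h y"
    have "m div 3 < m" if "m mod 3 \<noteq> 0" using that by (cases m) auto
    then have "v f m = v h m" using eq by (auto simp: v_def)
    moreover have "f ` {..<m} = h ` {..<m}" using eq by (intro image_cong) auto
    ultimately show "step f m r = step h m r" by (simp add: step_def)
  next
    show "\<exists>r. step f m r" for f m unfolding step_def by (rule ext) simp
  qed
  then obtain f where "\<And>m. step f m (f m)" by blast
  then have f: "\<And>m. norm (f m) = 1" "\<And>i m. i < m \<Longrightarrow> cinner (f m) (f i) = 0"
    and vf: "\<And>m. v f m \<in> cspan (insert (f m) (f ` {..<m}))"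
    by (auto simp: step_def)
  have orth: "cinner (f i) (f j) = (if i = j then 1 else 0)" for i j
  proof (cases i j rule: linorder_cases)
    case equal
    then show ?thesis using norm_sq_eq_cinner[of "f j"] f(1)[of j] by simp
  next
    case less
    then show ?thesis using f(2)[of i j] cinner_commute[of "f i" "f j"] by simp
  qed (use f(2) in auto)
  have ins: "insert (f m) (f ` {..<m}) = f ` {..m}" for m by (auto simp: le_less)
  have v_span: "v f m \<in> cspan (f ` {..m})" for m using vf[of m] by (simp only: ins)
  have "D \<subseteq> cspan (range f)"
  proof
    fix x assume "x \<in> D"
    then obtain k where "x = g k" using g by blast
    then have "x = v f (3 * k)" by (simp add: v_def)
    moreover have "cspan (f ` {..3 * k}) \<subseteq> cspan (range f)" by (rule complex_vector.span_mono) auto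
    ultimately show "x \<in> cspan (range f)" using v_span[of "3 * k"] by auto
  qed
  then have "closure (cspan (range f)) = UNIV" using closure_mono D(2) by blast
  with orth have "orthonormal_basis f" by (simp add: orthonormal_basis_def)
  moreover have "v f (3 * k + 1) = A (f k)" for k
  proof -
    have "(3 * k + 1) mod 3 = 1" "(3 * k + 1) div 3 = k" by presburger+
    then show ?thesis by (simp add: v_def)
  qed
  moreover have "v f (3 * k + 2) = B (f k)" for k
  proof -
    have "(3 * k + 2) mod 3 = 2" "(3 * k + 2) div 3 = k" by presburger+
    then show ?thesis by (simp add: v_def)
  qed
  ultimately show ?thesis by (metis v_span)
qed

text \<open>If \<open>k\<close> is in one of the first \<open>q + 1\<close> blocks, then \<open>k < 3\<^sup>q\<close> and \<open>3 k + 2 < 3\<^sup>q\<^sup>+\<^sup>1\<close>, so \<open>T (f k)\<close> and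
\<open>T\<^sup>* (f k)\<close> are combinations of the first \<open>q + 2\<close> blocks. This says that the matrix of \<open>T\<close> vanishes more
than one block below and more than one block above the diagonal. The basis \<open>h\<close> only serves to
provide the adjoint of \<open>T\<close>, on which the choice of \<open>f\<close> depends.\<close>

lemma ex_tridiagonalization:
  fixes T :: "'a::complex_hilbert \<Rightarrow> 'a"
  assumes "separable_space (euclidean :: 'a topology)" "infinite_dimensional TYPE('a)" "bounded_clinear T"
  shows "\<exists>f. tridiagonalization T f id"
proof -
  obtain h :: "nat \<Rightarrow> 'a" where "orthonormal_basis h"
    using ex_basis_controlling_images[OF assms(1,2)] by blast
  then interpret h: hilbert_basis h by unfold_locales
  obtain f where f: "orthonormal_basis f" "\<And>k. T (f k) \<in> cspan (f ` {..3 * k + 1})"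
    "\<And>k. cadjoint T (f k) \<in> cspan (f ` {..3 * k + 2})"
    using ex_basis_controlling_images[OF assms(1,2), of T "cadjoint T"] by blast
  interpret hilbert_basis f using f(1) by unfold_locales
  have coord: "cinner x (f i) = 0" if "x \<in> cspan (f ` {..3 * k + 2})" "Suc (bindex k) < bindex i" for x i k
  proof -
    define q where "q = bindex k"
    have "k < bstart (Suc q)" using bindex_eq_iff[of k q] by (simp add: q_def)
    then have "3 * k + 2 < bstart (Suc (Suc q))" by (simp add: bstart_Suc_eq)
    also have "\<dots> \<le> bstart (bindex i)" using that(2) by (intro bstart_mono) (simp add: q_def)
    also have "\<dots> \<le> i" by (rule bstart_bindex_le)
    finally have "cinner (f i) x = 0"
      by (intro cinner_eq_zero_cspan[OF _ that(1)]) auto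
    then show ?thesis using cinner_commute[of x "f i"] by simp
  qed
  have "entry f T i j = 0" if "Suc (bindex i) < bindex j \<or> Suc (bindex j) < bindex i" for i j
    using that
  proof
    assume *: "Suc (bindex j) < bindex i"
    have "T (f j) \<in> cspan (f ` {..3 * j + 2})"
      using f(2)[of j] complex_vector.span_mono[OF image_mono[of "{..3 * j + 1}" "{..3 * j + 2}" f]] by auto
    then show ?thesis using coord * by (simp add: entry_def)
  next
    assume *: "Suc (bindex i) < bindex j"
    have "entry f (cadjoint T) j i = 0" using coord[OF f(3)] * by (simp add: entry_def)
    then show ?thesis using entry_cadjoint[OF assms(3), of j i] by simp
  qed
  then have "block_tridiagonal f T"
    unfolding block_tridiagonal_def
    by (auto simp: block_def bindex_bstart_add intro!: eq_matI)
  then show ?thesis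
    using f(1) unitary_op_id by (auto simp: tridiagonalization_def conj_op_id)
qed

section \<open>The splitting of a block tridiagonal compact operator\<close>

context hilbert_basis
begin

lemma block_tridiagonal_entry_eq_0:
  assumes "block_tridiagonal f K" "Suc (bindex i) < bindex j \<or> Suc (bindex j) < bindex i"
  shows "entry f K i j = 0"
proof -
  have "block f K (bindex i) (bindex j) = 0\<^sub>m (bsize (bindex i)) (bsize (bindex j))"
    using assms unfolding block_tridiagonal_def by blast
  then show ?thesis using block_entry[of f K i j] by (simp add: offset_less)
qed

text \<open>\<open>Q\<close> is a masked version of \<open>K\<close>, with the mask shifted by one block; hence \<open>Q\<close> is compact, and the
series defining \<open>S\<close> converge to the bounded operator \<open>K - Q\<close>.\<close>

lemma S_op_eq:
  assumes K: "compact_op K" and tri: "block_tridiagonal f K"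
  obtains Q where "compact_op Q" "S_op f K = (\<lambda>x. K x - Q x)"
    "\<And>i j. entry f Q i j = (if bindex i = Suc (bindex j) then entry f K i j else 0)"
proof -
  obtain Q where Q: "compact_op Q"
    "\<And>i j. entry f Q i j = (if bindex i = Suc (bindex j) then entry f K i j else 0)"
    using ex_compact_masked_operator[OF K, of bindex "\<lambda>j. Suc (bindex j)"] finite_bindex_fibre by blast
  have "S_op f K = (\<lambda>x. K x - Q x)"
    unfolding S_op_def op_of_blocks_def
  proof (rule op_of_matrix_eq)
    show "bounded_clinear (\<lambda>x. K x - Q x)"
      using K Q(1) by (intro bounded_clinear_minus) (auto simp: compact_op_def)
    fix i j
    have entry_diff: "entry f (\<lambda>x. K x - Q x) i j = entry f K i j - entry f Q i j"
      by (simp add: entry_def cinner_diff_left)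
    consider "bindex j = bindex i" | "bindex j = Suc (bindex i)" | "bindex i = Suc (bindex j)"
      | "Suc (bindex i) < bindex j \<or> Suc (bindex j) < bindex i" by linarith
    then show "entry f (\<lambda>x. K x - Q x) i j =
      (if bindex j = bindex i then C_block f K (bindex i)
       else if bindex j = Suc (bindex i) then A_block f K (bindex i) else 0\<^sub>m (bsize (bindex i)) (bsize (bindex j))) $$
      (i - bstart (bindex i), j - bstart (bindex j))"
    proof cases
      case 4
      then show ?thesis
        using block_tridiagonal_entry_eq_0[OF tri 4] by (auto simp: entry_diff Q(2) offset_less)
    qed (use block_entry[of f K i j] offset_less[of i] offset_less[of j] in \<open>simp_all add: entry_diff Q(2) C_block_def A_block_def offset_less\<close>)
  qed
  with Q that show ?thesis by blast
qed

lemma entry_conj_direct_sum_op: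
  assumes "\<And>n. unitary_mat (bsize n) (Us n)" "bounded_clinear A"
  shows "entry f (conj_op (direct_sum_op f Us) A) i j =
    (\<Sum>k | bindex k = bindex i. \<Sum>l | bindex l = bindex j.
      cnj (entry f (direct_sum_op f Us) k i) * entry f A k l * entry f (direct_sum_op f Us) l j)"
  by (intro entry_conj_op_sum assms bounded_clinear_direct_sum_op finite_bindex_fibre)
    (auto simp: entry_direct_sum_op assms(1))

text \<open>\<open>Z\<close> is \<open>U\<^sup>* Q U\<close>. Conjugation by the block diagonal \<open>U\<close> does not move entries between blocks, so \<open>Z\<close>
still maps each block into the next, which makes it strictly lower triangular entry by entry, while
\<open>\<Delta>\<close> vanishes below the block diagonal and has the triangular matrices \<open>U\<^sub>n\<^sup>* C\<^sub>n U\<^sub>n\<close> on it.\<close>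

lemma Delta_op_splitting:
  assumes K: "compact_op K" and tri: "block_tridiagonal f K" and Us: "triangularizes_blocks f K Us"
  obtains Z where "compact_op Z" "\<And>i j. i \<le> j \<Longrightarrow> entry f Z i j = 0"
    "conj_op (direct_sum_op f Us) K = (\<lambda>x. Delta_op f K Us x + Z x)"
    "compact_op (Delta_op f K Us)" "upper_triangular_op f (Delta_op f K Us)"
proof -
  let ?U = "direct_sum_op f Us" and ?\<Delta> = "Delta_op f K Us"
  have U: "\<And>n. unitary_mat (bsize n) (Us n)" using Us by (simp add: triangularizes_blocks_def)
  note linU = bounded_clinear_direct_sum_op[OF U]
  obtain Q where Q: "compact_op Q" "S_op f K = (\<lambda>x. K x - Q x)"
    "\<And>i j. entry f Q i j = (if bindex i = Suc (bindex j) then entry f K i j else 0)"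
    using S_op_eq[OF K tri] by blast
  have S: "compact_op (S_op f K)" using compact_op_diff[OF K Q(1)] by (simp add: Q(2))
  then have linS: "bounded_clinear (S_op f K)" and linQ: "bounded_clinear Q" using Q(1) by (auto simp: compact_op_def)
  have entry_S: "entry f (S_op f K) i j = entry f K i j - entry f Q i j" for i j
    by (simp add: Q(2) entry_def cinner_diff_left)
  define Z where "Z = conj_op ?U Q"
  have cZ: "compact_op Z" unfolding Z_def by (intro compact_op_conj_op Q linU)
  have c\<Delta>: "compact_op ?\<Delta>" unfolding Delta_op_def by (intro compact_op_conj_op S linU)
  have Z0: "entry f Z i j = 0" if "i \<le> j" for i j
    using bindex_mono[OF that] unfolding Z_def
    by (auto simp: entry_conj_direct_sum_op[OF U linQ] Q(3) intro!: sum.neutral)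
  have sum: "conj_op ?U K = (\<lambda>x. ?\<Delta> x + Z x)"
    using bounded_clinear_diff[OF bounded_clinear_cadjoint[OF linU]]
    by (simp add: Delta_op_def Z_def conj_op_def Q(2) fun_eq_iff)
  have "entry f ?\<Delta> i j = 0" if "j < i" for i j
  proof (cases "bindex i = bindex j")
    case False
    then have "bindex j < bindex i" using bindex_mono[of j i] that by simp
    then show ?thesis
      unfolding Delta_op_def
      using block_tridiagonal_entry_eq_0[OF tri]
      by (auto simp: entry_conj_direct_sum_op[OF U linS] entry_S Q(3) intro!: sum.neutral)
  next
    case True
    define p where "p = bindex j"
    define X where "X = Us p"
    define C where "C = C_block f K p"
    have p: "bindex i = p" "bindex j = p" using True by (simp_all add: p_def)
    have X: "X \<in> carrier_mat (bsize p) (bsize p)" using U[of p] by (simp add: unitary_mat_def X_def)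
    have C: "C \<in> carrier_mat (bsize p) (bsize p)" by (simp add: C_def C_block_def block_def)
    have less: "i - bstart p < bsize p" "j - bstart p < bsize p"
      using offset_less[of i] offset_less[of j] p by auto
    have "entry f ?\<Delta> i j = (\<Sum>k<bsize p. \<Sum>l<bsize p. cnj (X $$ (k, i - bstart p)) * C $$ (k, l) * X $$ (l, j - bstart p))"
      unfolding Delta_op_def entry_conj_direct_sum_op[OF U linS] p sum_bindex_fibre
      by (intro sum.cong refl)
        (simp add: entry_direct_sum_op[OF U] bindex_bstart_add p X_def entry_S Q(3) C_def C_block_def block_def)
    also have "\<dots> = (\<Sum>l<bsize p. \<Sum>k<bsize p. cnj (X $$ (k, i - bstart p)) * C $$ (k, l) * X $$ (l, j - bstart p))"
      by (rule sum.swap)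
    also have "\<dots> = (mat_adjoint X * C * X) $$ (i - bstart p, j - bstart p)"
      using X C less by (simp add: mat_mult_index[of _ "bsize p"] mat_adjoint_carrier mat_adjoint_index[of _ "bsize p"]
          mult_carrier_mat[of _ "bsize p" "bsize p"] sum_distrib_right del: index_mult_mat)
    also have "\<dots> = 0"
    proof (rule upper_triangularD)
      show "upper_triangular (mat_adjoint X * C * X)"
        using Us by (simp add: triangularizes_blocks_def X_def C_def)
      show "j - bstart p < i - bstart p" using that bstart_bindex_le[of j] p by simp
      show "i - bstart p < dim_row (mat_adjoint X * C * X)"
        using less mat_adjoint_carrier[OF X] by auto
    qed
    finally show ?thesis .
  qed
  then have "upper_triangular_op f ?\<Delta>" by (simp add: upper_triangular_op_def)
  with cZ Z0 sum c\<Delta> that show ?thesis by blast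
qed

lemma diagonal_part_of_compact:
  assumes A: "compact_op A"
  shows compact_diagonal_part: "compact_op (diagonal_part f A)"
    and entry_diagonal_part: "entry f (diagonal_part f A) i j = (if i = j then entry f A i i else 0)"
proof -
  obtain N where N: "compact_op N" "\<And>i j. entry f N i j = (if i = j then entry f A i j else 0)"
    using ex_compact_masked_operator[OF A, of id id] by auto
  have "diagonal_part f A = N"
    unfolding diagonal_part_def using N by (intro op_of_matrix_eq) (auto simp: compact_op_def)
  with N show "compact_op (diagonal_part f A)"
    "entry f (diagonal_part f A) i j = (if i = j then entry f A i i else 0)" by simp_all
qed

lemma normal_op_of_diagonal:
  assumes N: "bounded_clinear N" and diag: "\<And>i j. i \<noteq> j \<Longrightarrow> entry f N i j = 0"
  shows "normal_op N"
proof -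
  have adj: "entry f (cadjoint N) i j = (if i = j then cnj (entry f N i i) else 0)" for i j
    using diag[of j i] by (simp add: entry_cadjoint[OF N])
  have "cadjoint N \<circ> N = N \<circ> cadjoint N"
  proof (intro eq_by_entries bounded_clinear_compose bounded_clinear_cadjoint N)
    fix i j
    have "entry f (cadjoint N \<circ> N) i j = (\<Sum>k\<in>{j}. entry f (cadjoint N) i k * entry f N k j)"
      by (intro entry_compose bounded_clinear_cadjoint N) (auto intro: diag)
    moreover have "entry f (N \<circ> cadjoint N) i j = (\<Sum>k\<in>{j}. entry f N i k * entry f (cadjoint N) k j)"
      by (intro entry_compose N) (auto simp: adj)
    ultimately show "entry f (cadjoint N \<circ> N) i j = entry f (N \<circ> cadjoint N) i j"
      using diag[of i j] by (simp add: adj)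
  qed
  with N show ?thesis by (simp add: normal_op_def)
qed

lemma quasinilpotent_of_strictly_triangular:
  assumes "compact_op A" "(\<forall>i j. i \<le> j \<longrightarrow> entry f A i j = 0) \<or> (\<forall>i j. j \<le> i \<longrightarrow> entry f A i j = 0)"
  shows "quasinilpotent A"
  using strictly_triangular_spectrum[OF assms] assms(1) by (simp add: quasinilpotent_def compact_op_def)

lemma ex_triangularizes_blocks: "\<exists>Us. triangularizes_blocks f K Us"
proof -
  have "\<forall>n. \<exists>U. unitary_mat (bsize n) U \<and> upper_triangular (mat_adjoint U * C_block f K n * U)"
    by (intro allI ex_unitary_schur) (simp add: C_block_def block_def)
  then show ?thesis unfolding triangularizes_blocks_def by metis
qed

end

lemma tridiagonalized_compact:
  assumes "compact_op T" "tridiagonalization T f W"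
  shows "hilbert_basis f" "compact_op (conj_op W T)" "block_tridiagonal f (conj_op W T)"
    "unitary_op W" "bounded_clinear W"
proof -
  show f: "hilbert_basis f" using assms(2) by unfold_locales (simp add: tridiagonalization_def)
  show W: "unitary_op W" "bounded_clinear W" and "block_tridiagonal f (conj_op W T)"
    using assms(2) by (simp_all add: tridiagonalization_def unitary_op_def)
  show "compact_op (conj_op W T)"
    using hilbert_basis.compact_op_conj_op[OF f assms(1) W(2)] .
qed

text \<open>Conjugation by \<open>U\<^sub>0\<close> is conjugation by \<open>W\<close> followed by conjugation by \<open>U\<close>, so the splitting of
\<open>K = W\<^sup>* T W\<close> is one of \<open>U\<^sub>0\<^sup>* T U\<^sub>0\<close>.\<close>

lemma splitting_of_compact:
  assumes T: "compact_op T" and fW: "tridiagonalization T f W"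
    and Us: "triangularizes_blocks f (conj_op W T) Us"
  defines "U0 \<equiv> W \<circ> direct_sum_op f Us" and "\<Delta> \<equiv> Delta_op f (conj_op W T) Us"
  obtains Z where "compact_op Z" "op_spectrum Z = {0}" "conj_op U0 T = (\<lambda>x. \<Delta> x + Z x)"
    "unitary_op U0" "compact_op (conj_op U0 T)" "compact_op \<Delta>" "upper_triangular_op f \<Delta>"
proof -
  interpret hilbert_basis f using tridiagonalized_compact(1)[OF T fW] .
  note K = tridiagonalized_compact(2-5)[OF T fW]
  have U: "\<And>n. unitary_mat (bsize n) (Us n)" using Us by (simp add: triangularizes_blocks_def)
  have U0: "unitary_op U0" unfolding U0_def by (intro unitary_op_compose K unitary_direct_sum_op U)
  then have "bounded_clinear U0" by (simp add: unitary_op_def)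
  then have cK': "compact_op (conj_op U0 T)" by (intro compact_op_conj_op T)
  have eq: "conj_op U0 T = conj_op (direct_sum_op f Us) (conj_op W T)"
    unfolding U0_def by (intro conj_op_compose K bounded_clinear_direct_sum_op U)
  obtain Z where Z: "compact_op Z" "\<And>i j. i \<le> j \<Longrightarrow> entry f Z i j = 0"
    "conj_op (direct_sum_op f Us) (conj_op W T) = (\<lambda>x. \<Delta> x + Z x)"
    "compact_op \<Delta>" "upper_triangular_op f \<Delta>"
    using Delta_op_splitting[OF K(1,2) Us] unfolding \<Delta>_def by blast
  have "op_spectrum Z = {0}" using Z by (intro strictly_triangular_spectrum) blast+
  with Z eq U0 cK' that show ?thesis by metis
qed

theorem theorem3p1:
  fixes T :: "'a::complex_hilbert \<Rightarrow> 'a"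
  assumes separable: "separable_space (euclidean :: 'a topology)"
    and infinite_dim: "infinite_dimensional TYPE('a)"
    and compact_T: "compact_op T"
  shows
    "(\<exists>f W Us. tridiagonalization T f W \<and> triangularizes_blocks f (conj_op W T) Us) \<and>
     (\<exists>f W. tridiagonalization T f W \<and>
        (\<exists>R Z. compact_op R \<and> upper_triangularizable f R \<and>
           compact_op Z \<and> quasinilpotent Z \<and> unitarily_equivalent T (\<lambda>x. R x + Z x))) \<and>
     (\<forall>f W Us. tridiagonalization T f W \<and> triangularizes_blocks f (conj_op W T) Us \<longrightarrow>
        (let U0 = W \<circ> direct_sum_op f Us; \<Delta> = Delta_op f (conj_op W T) Us
         in op_spectrum (\<lambda>x. conj_op U0 T x - \<Delta> x) = {0})) \<and>
     (\<forall>f W. tridiagonalization T f W \<and>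
        (\<forall>n. B_block f (conj_op W T) n = 0\<^sub>m (bsize (Suc n)) (bsize n)) \<longrightarrow>
        upper_triangularizable f (conj_op W T)) \<and>
     (\<forall>f W Us. tridiagonalization T f W \<and> triangularizes_blocks f (conj_op W T) Us \<longrightarrow>
        (let U0 = W \<circ> direct_sum_op f Us; \<Delta> = Delta_op f (conj_op W T) Us;
             K' = conj_op U0 T; N = diagonal_part f \<Delta>
         in unitarily_equivalent T K' \<and> compact_op K' \<and> normal_op N \<and>
            (\<exists>Q1 Q2. compact_op Q1 \<and> quasinilpotent Q1 \<and> compact_op Q2 \<and> quasinilpotent Q2 \<and>
               (\<lambda>x. K' x - N x) = (\<lambda>x. Q1 x + Q2 x))))"
proof -
  have lin: "bounded_clinear T" using compact_T by (simp add: compact_op_def)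
  obtain f Us where ex: "tridiagonalization T f id" "triangularizes_blocks f (conj_op id T) Us"
  proof -
    obtain f where f: "tridiagonalization T f id"
      using ex_tridiagonalization[OF separable infinite_dim lin] by blast
    interpret hilbert_basis f using tridiagonalized_compact(1)[OF compact_T f] .
    from f that show thesis using ex_triangularizes_blocks by blast
  qed
  have "\<exists>f W Us. tridiagonalization T f W \<and> triangularizes_blocks f (conj_op W T) Us"
    using ex by blast
  moreover have "\<exists>f W. tridiagonalization T f W \<and>
        (\<exists>R Z. compact_op R \<and> upper_triangularizable f R \<and>
           compact_op Z \<and> quasinilpotent Z \<and> unitarily_equivalent T (\<lambda>x. R x + Z x))"
  proof -
    interpret hilbert_basis f using tridiagonalized_compact(1)[OF compact_T ex(1)] .
    let ?\<Delta> = "Delta_op f (conj_op id T) Us" and ?U0 = "id \<circ> direct_sum_op f Us"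
    obtain Z where Z: "compact_op Z" "op_spectrum Z = {0}" "conj_op ?U0 T = (\<lambda>x. ?\<Delta> x + Z x)"
      "unitary_op ?U0" "compact_op ?\<Delta>" "upper_triangular_op f ?\<Delta>"
      by (rule splitting_of_compact[OF compact_T ex]) (rule that)
    have "upper_triangularizable f ?\<Delta>"
      unfolding upper_triangularizable_def
      using Z(6) by (intro exI[of _ id] conjI unitary_op_id) (simp add: conj_op_id)
    moreover have "quasinilpotent Z" using Z(1,2) by (simp add: quasinilpotent_def compact_op_def)
    moreover have "unitarily_equivalent T (\<lambda>x. ?\<Delta> x + Z x)"
      unfolding unitarily_equivalent_def by (intro exI[of _ ?U0] conjI Z(4) Z(3)[symmetric])
    ultimately show ?thesis using ex(1) Z(1,5) by blast
  qed
  moreover have "op_spectrum (\<lambda>x. conj_op (W \<circ> direct_sum_op f Us) T x - Delta_op f (conj_op W T) Us x) = {0}"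
    if fW: "tridiagonalization T f W" and Us: "triangularizes_blocks f (conj_op W T) Us" for f W Us
  proof -
    obtain Z where Z: "op_spectrum Z = {0}"
      "conj_op (W \<circ> direct_sum_op f Us) T = (\<lambda>x. Delta_op f (conj_op W T) Us x + Z x)"
      by (rule splitting_of_compact[OF compact_T fW Us]) blast
    show ?thesis unfolding Z(2) using Z(1) by simp
  qed
  moreover have "upper_triangularizable f (conj_op W T)"
    if fW: "tridiagonalization T f W"
      and B: "\<forall>n. B_block f (conj_op W T) n = 0\<^sub>m (bsize (Suc n)) (bsize n)" for f W
  proof -
    let ?K = "conj_op W T"
    interpret hilbert_basis f using tridiagonalized_compact(1)[OF compact_T fW] .
    note K = tridiagonalized_compact(2,3)[OF compact_T fW]
    obtain Us where Us: "triangularizes_blocks f ?K Us" using ex_triangularizes_blocks by blast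
    then have U: "\<And>n. unitary_mat (bsize n) (Us n)" by (simp add: triangularizes_blocks_def)
    obtain Q where Q: "compact_op Q" "S_op f ?K = (\<lambda>x. ?K x - Q x)"
      "\<And>i j. entry f Q i j = (if bindex i = Suc (bindex j) then entry f ?K i j else 0)"
      using S_op_eq[OF K] by blast
    have "entry f Q i j = 0" for i j
    proof (cases "bindex i = Suc (bindex j)")
      case True
      then have "block f ?K (bindex i) (bindex j) = 0\<^sub>m (bsize (bindex i)) (bsize (bindex j))"
        using B by (simp add: B_block_def)
      then have "entry f ?K i j = 0" using block_entry[of f ?K i j] by (simp add: offset_less)
      then show ?thesis using Q(3) by simp
    qed (simp add: Q(3))
    moreover have "bounded_clinear (\<lambda>x. 0 :: 'a)" by (rule bounded_clinearI[where K = 0]) simp_all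
    ultimately have "Q = (\<lambda>x. 0)"
      using Q(1) by (intro eq_by_entries) (auto simp: compact_op_def entry_def)
    then have "S_op f ?K = ?K" using Q(2) by simp
    then have "conj_op (direct_sum_op f Us) ?K = Delta_op f ?K Us" by (simp add: Delta_op_def)
    moreover have "upper_triangular_op f (Delta_op f ?K Us)" using Delta_op_splitting[OF K Us] by blast
    ultimately show ?thesis
      unfolding upper_triangularizable_def using unitary_direct_sum_op[OF U] by metis
  qed
  moreover have "unitarily_equivalent T K' \<and> compact_op K' \<and> normal_op N \<and>
            (\<exists>Q1 Q2. compact_op Q1 \<and> quasinilpotent Q1 \<and> compact_op Q2 \<and> quasinilpotent Q2 \<and>
               (\<lambda>x. K' x - N x) = (\<lambda>x. Q1 x + Q2 x))"
    if fW: "tridiagonalization T f W" and Us: "triangularizes_blocks f (conj_op W T) Us"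
      and K'_eq: "K' = conj_op (W \<circ> direct_sum_op f Us) T"
      and N_eq: "N = diagonal_part f (Delta_op f (conj_op W T) Us)" for f W Us K' N
  proof -
    let ?\<Delta> = "Delta_op f (conj_op W T) Us"
    interpret hilbert_basis f using tridiagonalized_compact(1)[OF compact_T fW] .
    obtain Z where Z: "compact_op Z" "op_spectrum Z = {0}" "K' = (\<lambda>x. ?\<Delta> x + Z x)"
      "unitary_op (W \<circ> direct_sum_op f Us)" "compact_op K'" "compact_op ?\<Delta>" "upper_triangular_op f ?\<Delta>"
      using splitting_of_compact[OF compact_T fW Us] unfolding K'_eq by blast
    have N: "compact_op N" "\<And>i j. entry f N i j = (if i = j then entry f ?\<Delta> i i else 0)"
      unfolding N_eq using compact_diagonal_part[OF Z(6)] entry_diagonal_part[OF Z(6)] by blast+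
    define Q2 where "Q2 x = ?\<Delta> x - N x" for x
    have cQ2: "compact_op Q2" using compact_op_diff[OF Z(6) N(1)] by (simp add: Q2_def[abs_def])
    have "entry f Q2 i j = entry f ?\<Delta> i j - entry f N i j" for i j
      by (simp add: entry_def Q2_def cinner_diff_left)
    then have "\<forall>i j. j \<le> i \<longrightarrow> entry f Q2 i j = 0"
      using Z(7) by (auto simp: N(2) upper_triangular_op_def le_less)
    then have "quasinilpotent Q2" using cQ2 by (intro quasinilpotent_of_strictly_triangular) blast+
    moreover have "quasinilpotent Z" using Z(1,2) by (simp add: quasinilpotent_def compact_op_def)
    moreover have "(\<lambda>x. K' x - N x) = (\<lambda>x. Z x + Q2 x)" by (simp add: Z(3) Q2_def fun_eq_iff)
    moreover have "normal_op N" using N by (intro normal_op_of_diagonal) (auto simp: compact_op_def)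
    moreover have "unitarily_equivalent T K'" unfolding unitarily_equivalent_def K'_eq using Z(4) by blast
    ultimately show ?thesis using Z(1,5) cQ2 by blast
  qed
  ultimately show ?thesis by (simp add: Let_def)
qed

end
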